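(* There exists a finite skew brace $(B,+,\circ)$ such that the additive group $(B,+)$ is soluble and the multiplicative group $(B,\circ)$ is insoluble. More precisely, there is such a skew brace for which $$(B,+)\simeq\left(\mathbf F_7^{\,8}\rtimes(\mathbf F_3^{\,7}\rtimes\mathbf F_2^{\,3})\right)^{\mathrm{op}}$$ for some semidirect products of the indicated form (with $\mathbf F_7^{\,8},\mathbf F_3^{\,7},\mathbf F_2^{\,3}$ regarded as additive groups), whereas $(B,\circ)$ has a normal soluble subgroup $H$ satisfying $$(B,\circ)/H\simeq\mathrm{GL}_3(2)\simeq\mathrm{PSL}_2(7).$$ In particular, Byott's conjecture is false: there exists a finite soluble group $N$ such that $\mathrm{Hol}(N)$ has an insoluble regular subgroup.
   Context: A skew brace is a set $B$ with two group operations $+$ and $\circ$ ($(B,+)$ not necessarily abelian) such that $a\circ(b+c)=(a\circ b)-a+(a\circ c)$ for all $a,b,c\in B$, where $-a$ is the inverse of $a$ in $(B,+)$. $\mathbf F_q$ is the field with $q$ elements. For a group $X$, $X^{\mathrm{op}}$ is the opposite group: same underlying set, with product $x\cdot_{\mathrm{op}}y=yx$. For a group $N$, $\mathrm{Hol}(N)=N\rtimes\mathrm{Aut}(N)$, acting naturally on $N$ (the pair $(n,\alpha)$ sends $x$ to $n\,\alpha(x)$); a subgroup of $\mathrm{Hol}(N)$ is regular if its natural action on $N$ is free and transitive. Byott's conjecture asserts that for every finite soluble group $N$, every regular subgroup of $\mathrm{Hol}(N)$ is soluble. *)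

theory Defs
  imports "HOL-Analysis.Analysis" "HOL-Algebra.Ring" "HOL-Algebra.Solvable_Groups" "HOL-Algebra.Bij"
begin

text \<open>
  The two group operations of a skew brace are carried by a HOL-Algebra ring record: the first
  group is \<^term>\<open>add_monoid B\<close>, and \<^term>\<open>B\<close> itself, read as a monoid, is the second one.
  Neither operation is assumed to be commutative.
\<close>

locale skew_brace =
  fixes B (structure)
  assumes add_group: "group (add_monoid B)"
    and mult_group: "group B"
    and brace_eq: "\<lbrakk>a \<in> carrier B; b \<in> carrier B; c \<in> carrier B\<rbrakk> \<Longrightarrow>
      a \<otimes> (b \<oplus> c) = ((a \<otimes> b) \<ominus> a) \<oplus> (a \<otimes> c)"

definition opposite_group :: "('a, 'm) monoid_scheme \<Rightarrow> ('a, 'm) monoid_scheme"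
  where "opposite_group G = G\<lparr>mult := \<lambda>x y. y \<otimes>\<^bsub>G\<^esub> x\<rparr>"

definition semidirect ::
    "('a, 'm) monoid_scheme \<Rightarrow> ('b, 'n) monoid_scheme \<Rightarrow> ('b \<Rightarrow> 'a \<Rightarrow> 'a) \<Rightarrow> ('a \<times> 'b) monoid"
  where "semidirect N H \<phi> =
    \<lparr>carrier = carrier N \<times> carrier H,
     mult = \<lambda>(n, h) (n', h'). (n \<otimes>\<^bsub>N\<^esub> \<phi> h n', h \<otimes>\<^bsub>H\<^esub> h'),
     one = (\<one>\<^bsub>N\<^esub>, \<one>\<^bsub>H\<^esub>)\<rparr>"

definition Hol :: "('a, 'm) monoid_scheme \<Rightarrow> ('a \<times> ('a \<Rightarrow> 'a)) monoid"
  where "Hol N = semidirect N (AutoGroup N) (\<lambda>\<alpha>. \<alpha>)"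

definition hol_act :: "('a, 'm) monoid_scheme \<Rightarrow> 'a \<times> ('a \<Rightarrow> 'a) \<Rightarrow> 'a \<Rightarrow> 'a"
  where "hol_act N = (\<lambda>(n, \<alpha>) x. n \<otimes>\<^bsub>N\<^esub> \<alpha> x)"

definition regular_subgroup :: "('a \<times> ('a \<Rightarrow> 'a)) set \<Rightarrow> ('a, 'm) monoid_scheme \<Rightarrow> bool"
  where "regular_subgroup R N \<longleftrightarrow>
    subgroup R (Hol N) \<and>
    (\<forall>g\<in>R. \<forall>x\<in>carrier N. hol_act N g x = x \<longrightarrow> g = \<one>\<^bsub>Hol N\<^esub>) \<and>
    (\<forall>x\<in>carrier N. \<forall>y\<in>carrier N. \<exists>g\<in>R. hol_act N g x = y)"

text \<open>Every finite group is isomorphic to one whose elements are natural numbers.\<close>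

definition Byott_conjecture :: bool
  where "Byott_conjecture \<longleftrightarrow>
    (\<forall>N :: nat monoid. group N \<and> finite (carrier N) \<and> solvable N \<longrightarrow>
      (\<forall>R. regular_subgroup R N \<longrightarrow> solvable ((Hol N)\<lparr>carrier := R\<rparr>)))"

text \<open>
  For a prime \<open>q\<close>, the field with \<open>q\<close> elements is the numeral type \<open>q\<close>, whose arithmetic is
  modulo \<open>q\<close>. The library only makes it a commutative ring; the lemmas \<open>F2_field\<close>,
  \<open>F3_field\<close>, \<open>F7_field\<close> below give the inverses.
\<close>

definition additive_group :: "'a::ab_group_add monoid"
  where "additive_group = \<lparr>carrier = UNIV, mult = (+), one = 0\<rparr>"

definition GL :: "('a::comm_ring_1^'n^'n) monoid"
  where "GL = \<lparr>carrier = {A. invertible A}, mult = (**), one = mat 1\<rparr>"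

definition SL :: "('a::comm_ring_1^'n^'n) monoid"
  where "SL = GL\<lparr>carrier := {A. invertible A \<and> det A = 1}\<rparr>"

definition group_center :: "('a, 'm) monoid_scheme \<Rightarrow> 'a set"
  where "group_center G =
    {z \<in> carrier G. \<forall>g\<in>carrier G. z \<otimes>\<^bsub>G\<^esub> g = g \<otimes>\<^bsub>G\<^esub> z}"

definition PSL :: "('a::comm_ring_1^'n^'n) set monoid"
  where "PSL = SL Mod group_center SL"

lemma F2_field:
  shows "CARD(2) = 2" and "(x::2) \<noteq> 0 \<Longrightarrow> \<exists>y. x * y = 1"
proof -
  assume "x \<noteq> 0"
  moreover obtain z where "x = of_int z" "0 \<le> z" "z < 2"
    by (cases x) auto
  ultimately have "x = 1" by (cases "z = 0"; cases "z = 1") auto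
  then show "\<exists>y. x * y = 1" by auto
qed simp

lemma F3_field:
  shows "CARD(3) = 3" and "(x::3) \<noteq> 0 \<Longrightarrow> \<exists>y. x * y = 1"
proof -
  assume "x \<noteq> 0"
  moreover obtain z where "x = of_int z" "0 \<le> z" "z < 3"
    by (cases x) auto
  moreover from this have "z \<in> {0, 1, 2}" by auto
  ultimately consider "x = 1" | "x = 2" by auto
  then show "\<exists>y. x * y = 1"
    by cases (rule exI[of _ 1], simp, rule exI[of _ 2], simp)
qed simp

lemma F7_field:
  shows "CARD(7) = 7" and "(x::7) \<noteq> 0 \<Longrightarrow> \<exists>y. x * y = 1"
proof -
  assume "x \<noteq> 0"
  moreover obtain z where "x = of_int z" "0 \<le> z" "z < 7"
    by (cases x) auto
  moreover from this have "z \<in> {0, 1, 2, 3, 4, 5, 6}" by auto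
  ultimately consider "x = 1" | "x = 2" | "x = 3" | "x = 4" | "x = 5" | "x = 6" by auto
  then show "\<exists>y. x * y = 1"
  proof cases
    case 1 then show ?thesis by (intro exI[of _ 1]) simp
  next
    case 2 then show ?thesis by (intro exI[of _ 4]) simp
  next
    case 3 then show ?thesis by (intro exI[of _ 5]) simp
  next
    case 4 then show ?thesis by (intro exI[of _ 2]) simp
  next
    case 5 then show ?thesis by (intro exI[of _ 3]) simp
  next
    case 6 then show ?thesis by (intro exI[of _ 6]) simp
  qed
qed simp

lemma (in group) semidirect_group:
  assumes H: "group H" and \<phi>: "\<phi> \<in> hom H (AutoGroup G)"
  shows "group (semidirect G H \<phi>)"
proof -
  interpret H: group H by (fact H)
  have aut: "\<phi> h \<in> hom G G" "\<phi> h \<in> Bij (carrier G)" if "h \<in> carrier H" for h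
    using \<phi> that by (auto simp: hom_def AutoGroup_def auto_def Pi_iff)
  have cl: "\<phi> h x \<in> carrier G" if "h \<in> carrier H" "x \<in> carrier G" for h x
    using aut(1)[OF that(1)] that(2) by (auto simp: hom_def)
  have mult: "\<phi> h (x \<otimes> y) = \<phi> h x \<otimes> \<phi> h y"
    if "h \<in> carrier H" "x \<in> carrier G" "y \<in> carrier G" for h x y
    using aut(1)[OF that(1)] that by (auto simp: hom_def)
  have comp: "\<phi> (h \<otimes>\<^bsub>H\<^esub> k) x = \<phi> h (\<phi> k x)"
    if "h \<in> carrier H" "k \<in> carrier H" "x \<in> carrier G" for h k x
    using \<phi> aut that by (auto simp: hom_def AutoGroup_def BijGroup_def compose_def)
  have id: "\<phi> \<one>\<^bsub>H\<^esub> x = x" if "x \<in> carrier G" for x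
    using hom_one[OF \<phi> H group.AutoGroup[OF is_group]] that
    by (simp add: AutoGroup_def BijGroup_def)
  show ?thesis
  proof (rule groupI)
    fix p assume "p \<in> carrier (semidirect G H \<phi>)"
    then obtain n h where p: "p = (n, h)" "n \<in> carrier G" "h \<in> carrier H"
      by (auto simp: semidirect_def)
    let ?k = "inv\<^bsub>H\<^esub> h"
    have "\<phi> ?k (inv n) \<otimes> \<phi> ?k n = \<one>"
      using p id by (simp flip: mult) (metis H.inv_closed H.l_inv cl comp id mult
          one_closed r_one l_cancel_one')
    then show "\<exists>q\<in>carrier (semidirect G H \<phi>). q \<otimes>\<^bsub>semidirect G H \<phi>\<^esub> p = \<one>\<^bsub>semidirect G H \<phi>\<^esub>"
      using p by (intro bexI[of _ "(\<phi> ?k (inv n), ?k)"]) (auto simp: semidirect_def cl)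
  qed (auto simp: semidirect_def cl mult comp id m_assoc H.m_assoc)
qed

end

theory Submission
  imports Defs "HOL-Algebra.Weak_Morphisms"
begin

text \<open>
  Let \<open>SL\<^sub>2(7)\<close> act on the 56 pairs of distinct points of the projective line over \<open>\<^bold>F\<^sub>7\<close>. Such
  pairs form eight affine lines over \<open>\<^bold>F\<^sub>7\<close>, one over each point. The exceptional isomorphism
  \<open>PSL\<^sub>2(7) \<simeq> GL\<^sub>3(2)\<close> makes the projective line an affine space over \<open>\<^bold>F\<^sub>2\<close> of dimension 3 on
  which \<open>SL\<^sub>2(7)\<close> acts by affine maps. Let \<open>N\<close> be the soluble group of permutations of the pairs
  that induce a translation of this affine space and act between fibres by
  \<open>x \<mapsto> m\<^sub>i + 2\<^bsup>w\<^sub>i\<^esup> x\<close>, where the exponents \<open>w\<^sub>i\<close> modulo 3 have sum 0; it is normalised by the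
  image \<open>Y\<close> of \<open>SL\<^sub>2(7)\<close>. Let \<open>X\<close> be the pointwise stabiliser of one fibre. As \<open>Y\<close> acts regularly,
  and \<open>N\<close> transitively, on the maps from that fibre induced by \<open>N\<close>, \<open>X \<inter> Y = 1\<close>, every \<open>n\<close> in \<open>N\<close> has a unique
  cofactor \<open>y\<^sub>n\<close> in \<open>Y\<close> with \<open>n y\<^sub>n\<close> in \<open>X\<close>, and every element of \<open>Y\<close> is such a cofactor. Then
  \<open>a \<circ> b = a y\<^sub>a b y\<^sub>a\<inverse>\<close> makes \<open>N\<close> a skew brace, and \<open>a \<mapsto> y\<^sub>a\<close> is a homomorphism from \<open>(N, \<circ>)\<close>
  onto \<open>Y\<close>, on whose kernel the two operations agree.
\<close>

subsection \<open>Skew braces from factorisations\<close>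

lemma (in group) inv_cancel:
  assumes "x \<in> carrier G" "y \<in> carrier G"
  shows "inv x \<otimes> (x \<otimes> y) = y" "x \<otimes> (inv x \<otimes> y) = y"
  using assms by (simp_all flip: m_assoc)

text \<open>The last two assumptions say that N lies in XY and Y lies in NX. N is embedded by
  \<open>\<iota>\<close> instead of being a subgroup, so that its elements can be natural numbers
  while the computations take place among permutations.\<close>

locale factorisation =
  N: group N + G: group G
  for N :: "'n monoid" (structure) and G :: "'g monoid" (structure) +
  fixes \<iota> :: "'n \<Rightarrow> 'g" and X Y :: "'g set"
  assumes \<iota>_hom: "\<iota> \<in> hom N G" and \<iota>_inj: "inj_on \<iota> (carrier N)"
    and X: "subgroup X G" and Y: "subgroup Y G"
    and normalises: "\<lbrakk>y \<in> Y; n \<in> carrier N\<rbrakk> \<Longrightarrow>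
      y \<otimes>\<^bsub>G\<^esub> \<iota> n \<otimes>\<^bsub>G\<^esub> inv\<^bsub>G\<^esub> y \<in> \<iota> ` carrier N"
    and X_Int_Y: "X \<inter> Y = {\<one>\<^bsub>G\<^esub>}"
    and ex_Y: "n \<in> carrier N \<Longrightarrow> \<exists>y\<in>Y. \<iota> n \<otimes>\<^bsub>G\<^esub> y \<in> X"
    and ex_N: "y \<in> Y \<Longrightarrow> \<exists>n\<in>carrier N. \<iota> n \<otimes>\<^bsub>G\<^esub> y \<in> X"
begin

definition cofactor :: "'n \<Rightarrow> 'g"
  where "cofactor n = (SOME y. y \<in> Y \<and> \<iota> n \<otimes>\<^bsub>G\<^esub> y \<in> X)"

definition circle :: "'n \<Rightarrow> 'n \<Rightarrow> 'n"
  where "circle a b = inv_into (carrier N) \<iota>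
    (\<iota> a \<otimes>\<^bsub>G\<^esub> (cofactor a \<otimes>\<^bsub>G\<^esub> \<iota> b \<otimes>\<^bsub>G\<^esub> inv\<^bsub>G\<^esub> cofactor a))"

definition brace :: "'n ring"
  where "brace = \<lparr>carrier = carrier N, mult = circle, one = \<one>\<^bsub>N\<^esub>,
    zero = \<one>\<^bsub>N\<^esub>, add = (\<otimes>\<^bsub>N\<^esub>)\<rparr>"

sublocale \<iota>: group_hom N G \<iota>
  using \<iota>_hom by unfold_locales

lemma cofactor:
  assumes "n \<in> carrier N"
  shows cofactor_in: "cofactor n \<in> Y" and cofactor_X: "\<iota> n \<otimes>\<^bsub>G\<^esub> cofactor n \<in> X"
proof -
  have "\<exists>y. y \<in> Y \<and> \<iota> n \<otimes>\<^bsub>G\<^esub> y \<in> X" using ex_Y[OF assms] by auto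
  from someI_ex[OF this] have "cofactor n \<in> Y \<and> \<iota> n \<otimes>\<^bsub>G\<^esub> cofactor n \<in> X"
    unfolding cofactor_def .
  then show "cofactor n \<in> Y" "\<iota> n \<otimes>\<^bsub>G\<^esub> cofactor n \<in> X" by auto
qed

lemma cofactor_closed [simp]: "n \<in> carrier N \<Longrightarrow> cofactor n \<in> carrier G"
  using cofactor_in subgroup.mem_carrier[OF Y] by blast

text \<open>Two cofactors of the same n differ by an element of X that also lies in Y.\<close>

lemma cofactor_unique:
  assumes "n \<in> carrier N" "y \<in> Y" "\<iota> n \<otimes>\<^bsub>G\<^esub> y \<in> X"
  shows "cofactor n = y"
proof -
  have cl: "y \<in> carrier G" using assms(2) subgroup.mem_carrier[OF Y] by blast
  have "inv\<^bsub>G\<^esub> (\<iota> n \<otimes>\<^bsub>G\<^esub> cofactor n) \<otimes>\<^bsub>G\<^esub> (\<iota> n \<otimes>\<^bsub>G\<^esub> y) \<in> X"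
    using cofactor_X assms X by (simp add: subgroup.m_closed subgroup.m_inv_closed)
  also have "inv\<^bsub>G\<^esub> (\<iota> n \<otimes>\<^bsub>G\<^esub> cofactor n) \<otimes>\<^bsub>G\<^esub> (\<iota> n \<otimes>\<^bsub>G\<^esub> y) = inv\<^bsub>G\<^esub> cofactor n \<otimes>\<^bsub>G\<^esub> y"
    using assms(1) cl by (simp add: G.inv_mult_group G.m_assoc G.inv_cancel)
  finally have "inv\<^bsub>G\<^esub> cofactor n \<otimes>\<^bsub>G\<^esub> y \<in> X \<inter> Y"
    using cofactor_in assms Y by (simp add: subgroup.m_closed subgroup.m_inv_closed)
  then have "inv\<^bsub>G\<^esub> cofactor n \<otimes>\<^bsub>G\<^esub> y = \<one>\<^bsub>G\<^esub>" using X_Int_Y by blast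
  then show ?thesis using assms(1) cl
    using G.inv_cancel(2)[of "cofactor n" y] by simp
qed

lemma cofactor_onto: "cofactor ` carrier N = Y"
  using cofactor_in cofactor_unique ex_N by (auto simp: image_iff) metis

lemma circle:
  assumes "a \<in> carrier N" "b \<in> carrier N"
  shows circle_closed: "circle a b \<in> carrier N"
    and \<iota>_circle: "\<iota> (circle a b) =
      \<iota> a \<otimes>\<^bsub>G\<^esub> (cofactor a \<otimes>\<^bsub>G\<^esub> \<iota> b \<otimes>\<^bsub>G\<^esub> inv\<^bsub>G\<^esub> cofactor a)"
proof -
  obtain c where "c \<in> carrier N" "cofactor a \<otimes>\<^bsub>G\<^esub> \<iota> b \<otimes>\<^bsub>G\<^esub> inv\<^bsub>G\<^esub> cofactor a = \<iota> c"
    using normalises[OF cofactor_in[OF assms(1)] assms(2)] unfolding image_iff by blast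
  then have "\<iota> a \<otimes>\<^bsub>G\<^esub> (cofactor a \<otimes>\<^bsub>G\<^esub> \<iota> b \<otimes>\<^bsub>G\<^esub> inv\<^bsub>G\<^esub> cofactor a) = \<iota> (a \<otimes>\<^bsub>N\<^esub> c)"
    "a \<otimes>\<^bsub>N\<^esub> c \<in> carrier N"
    using assms by auto
  then show "circle a b \<in> carrier N" "\<iota> (circle a b) =
      \<iota> a \<otimes>\<^bsub>G\<^esub> (cofactor a \<otimes>\<^bsub>G\<^esub> \<iota> b \<otimes>\<^bsub>G\<^esub> inv\<^bsub>G\<^esub> cofactor a)"
    unfolding circle_def using \<iota>_inj by auto
qed

text \<open>The definition of \<open>circle\<close> is made so that (a y_a)(b y_b) = (a \<circ>
  b)(y_a y_b). The left side lies in X, so uniqueness of cofactors applies.\<close>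

lemma cofactor_circle:
  assumes "a \<in> carrier N" "b \<in> carrier N"
  shows "cofactor (circle a b) = cofactor a \<otimes>\<^bsub>G\<^esub> cofactor b"
proof (rule cofactor_unique)
  have "\<iota> (circle a b) \<otimes>\<^bsub>G\<^esub> (cofactor a \<otimes>\<^bsub>G\<^esub> cofactor b)
      = (\<iota> a \<otimes>\<^bsub>G\<^esub> cofactor a) \<otimes>\<^bsub>G\<^esub> (\<iota> b \<otimes>\<^bsub>G\<^esub> cofactor b)"
    using assms by (simp add: \<iota>_circle G.m_assoc G.inv_cancel)
  then show "\<iota> (circle a b) \<otimes>\<^bsub>G\<^esub> (cofactor a \<otimes>\<^bsub>G\<^esub> cofactor b) \<in> X"
    using cofactor_X assms X by (simp add: subgroup.m_closed)
qed (use assms circle_closed cofactor_in Y in \<open>auto simp: subgroup.m_closed\<close>)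

lemma cofactor_one: "cofactor \<one>\<^bsub>N\<^esub> = \<one>\<^bsub>G\<^esub>"
  using X Y by (intro cofactor_unique) (auto simp: subgroup.one_closed)

lemma \<iota>_eqI: "\<lbrakk>\<iota> a = \<iota> b; a \<in> carrier N; b \<in> carrier N\<rbrakk> \<Longrightarrow> a = b"
  using \<iota>_inj by (auto dest: inj_onD)

lemma circle_one: "a \<in> carrier N \<Longrightarrow> circle \<one>\<^bsub>N\<^esub> a = a"
  by (rule \<iota>_eqI) (auto simp: \<iota>_circle circle_closed cofactor_one)

lemma circle_assoc:
  assumes "a \<in> carrier N" "b \<in> carrier N" "c \<in> carrier N"
  shows "circle (circle a b) c = circle a (circle b c)"
  using assms
  by (intro \<iota>_eqI)
    (simp_all add: \<iota>_circle circle_closed cofactor_circle G.m_assoc G.inv_mult_group G.inv_cancel)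

lemma circle_l_inv:
  assumes a: "a \<in> carrier N"
  shows "\<exists>b\<in>carrier N. circle b a = \<one>\<^bsub>N\<^esub>"
proof -
  let ?y = "inv\<^bsub>G\<^esub> cofactor a"
  have y: "?y \<in> Y" using a cofactor_in Y by (simp add: subgroup.m_inv_closed)
  \<comment> \<open>The inverse b is determined by b y_a^-1 = (a y_a)^-1. The right side lies in X,
    which identifies y_a^-1 as the cofactor of b.\<close>
  obtain b where b: "b \<in> carrier N" "?y \<otimes>\<^bsub>G\<^esub> \<iota> (inv\<^bsub>N\<^esub> a) \<otimes>\<^bsub>G\<^esub> inv\<^bsub>G\<^esub> ?y = \<iota> b"
    using normalises[OF y N.inv_closed[OF a]] unfolding image_iff by blast
  have "cofactor b = ?y"
  proof (rule cofactor_unique)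
    have "\<iota> b \<otimes>\<^bsub>G\<^esub> ?y = ?y \<otimes>\<^bsub>G\<^esub> \<iota> (inv\<^bsub>N\<^esub> a)"
      using a by (simp add: b(2)[symmetric] G.m_assoc)
    also have "\<dots> = inv\<^bsub>G\<^esub> (\<iota> a \<otimes>\<^bsub>G\<^esub> cofactor a)"
      using a by (simp add: G.inv_mult_group)
    finally show "\<iota> b \<otimes>\<^bsub>G\<^esub> ?y \<in> X" using cofactor_X[OF a] X by (simp add: subgroup.m_inv_closed)
  qed (use b y in auto)
  then have "circle b a = \<one>\<^bsub>N\<^esub>"
    using a b(1) by (intro \<iota>_eqI)
      (simp_all add: \<iota>_circle circle_closed b(2)[symmetric] G.m_assoc G.inv_cancel)
  then show ?thesis using b by auto
qed

lemma add_monoid_brace [simp]: "add_monoid brace = N"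
  by (simp add: brace_def)

lemma brace_simps [simp]: "carrier brace = carrier N" "mult brace = circle" "one brace = \<one>\<^bsub>N\<^esub>"
  "zero brace = \<one>\<^bsub>N\<^esub>" "add brace = mult N"
  by (simp_all add: brace_def)

lemma group_brace: "group brace"
  by (rule groupI) (auto simp: circle_closed circle_one circle_assoc circle_l_inv)

text \<open>Conjugation by y_a is multiplicative, so a \<circ> (b c) equals a b' c' with b', c' the
  conjugates of b, c. Inserting a^-1 a between b' and c' gives the brace equation.\<close>

lemma skew_brace: "skew_brace brace"
proof (rule skew_brace.intro)
  fix a b c assume "a \<in> carrier brace" "b \<in> carrier brace" "c \<in> carrier brace"
  then have abc: "a \<in> carrier N" "b \<in> carrier N" "c \<in> carrier N" by auto
  have "circle a (b \<otimes>\<^bsub>N\<^esub> c) = circle a b \<otimes>\<^bsub>N\<^esub> inv\<^bsub>N\<^esub> a \<otimes>\<^bsub>N\<^esub> circle a c"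
    using abc
    by (intro \<iota>_eqI) (simp_all add: \<iota>_circle circle_closed G.m_assoc G.inv_cancel)
  then show "a \<otimes>\<^bsub>brace\<^esub> (b \<oplus>\<^bsub>brace\<^esub> c) =
      ((a \<otimes>\<^bsub>brace\<^esub> b) \<ominus>\<^bsub>brace\<^esub> a) \<oplus>\<^bsub>brace\<^esub> (a \<otimes>\<^bsub>brace\<^esub> c)"
    unfolding a_minus_def a_inv_def add_monoid_brace by simp
qed (simp_all only: add_monoid_brace group_brace N.is_group)

lemma cofactor_hom: "cofactor \<in> hom brace (G\<lparr>carrier := Y\<rparr>)"
  by (auto simp: hom_def cofactor_in cofactor_circle)

lemma circle_trivial:
  assumes "a \<in> carrier N" "b \<in> carrier N" "cofactor a = \<one>\<^bsub>G\<^esub>"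
  shows "circle a b = a \<otimes>\<^bsub>N\<^esub> b"
  using assms by (intro \<iota>_eqI) (auto simp: \<iota>_circle circle_closed)

end

section \<open>Transfer of solvability, and solvable kernels in skew braces\<close>

lemma solvable_cong:
  assumes "group G" "group H" "carrier G = carrier H"
    and "\<And>x y. \<lbrakk>x \<in> carrier G; y \<in> carrier G\<rbrakk> \<Longrightarrow> x \<otimes>\<^bsub>G\<^esub> y = x \<otimes>\<^bsub>H\<^esub> y"
    and "solvable G"
  shows "solvable H"
proof -
  have "group_hom G H (\<lambda>x. x)"
    using assms by (auto simp: group_hom_def group_hom_axioms_def hom_def)
  from group_hom.surj_hom_imp_solvable[OF this] assms show ?thesis by simp
qed

lemma (in group) subgroup_solvable:
  assumes "subgroup H G" "solvable G"
  shows "solvable (G\<lparr>carrier := H\<rparr>)"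
proof -
  interpret H: group "G\<lparr>carrier := H\<rparr>" using assms(1) by (simp add: subgroup_imp_group)
  have "group_hom (G\<lparr>carrier := H\<rparr>) G (\<lambda>x. x)"
    using assms(1) subgroup.subset[OF assms(1)]
    by (auto simp: group_hom_def group_hom_axioms_def hom_def)
  from group_hom.inj_hom_imp_solvable[OF this] assms show ?thesis by (simp add: inj_on_def)
qed

lemma iso_solvable:
  assumes "group G" "group H" "G \<cong> H" "solvable G"
  shows "solvable H"
proof -
  obtain f where "f \<in> iso G H" using assms by (auto simp: is_iso_def)
  then have "group_hom G H f" "f ` carrier G = carrier H"
    using assms by (auto simp: group_hom_def group_hom_axioms_def iso_def bij_betw_def)
  with group_hom.surj_hom_imp_solvable assms show ?thesis by blast
qed

text \<open>The two operations agree on the kernel, so it is also a subgroup of the additive group,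
  with the same inverses, and is solvable as such.\<close>

lemma (in skew_brace) solvable_kernel:
  assumes Q: "group Q" and h: "h \<in> hom B Q"
    and eq: "\<And>a b. \<lbrakk>a \<in> carrier B; b \<in> carrier B; h a = \<one>\<^bsub>Q\<^esub>\<rbrakk> \<Longrightarrow> a \<otimes> b = a \<oplus> b"
    and sol: "solvable (add_monoid B)"
  shows "solvable (B\<lparr>carrier := kernel B Q h\<rparr>)"
proof -
  interpret A: group "add_monoid B" by (fact add_group)
  interpret M: group B by (fact mult_group)
  interpret h: group_hom B Q h using Q h by (simp add: group_hom_def group_hom_axioms_def M.is_group)
  let ?K = "kernel B Q h"
  have K: "subgroup ?K B" by (fact h.subgroup_kernel)
  have sum: "a \<oplus> b \<in> ?K" if "a \<in> ?K" "b \<in> ?K" for a b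
    using that subgroup.m_closed[OF K, of a b] eq[of a b] by (auto simp: kernel_def)
  have one: "\<one> = \<zero>"
    using eq[of \<one> \<one>] A.l_cancel_one[of \<one> \<one>] by auto
  have inv: "inv\<^bsub>add_monoid B\<^esub> a \<in> ?K" if "a \<in> ?K" for a
  proof -
    have a: "a \<in> carrier B" "h a = \<one>\<^bsub>Q\<^esub>" using that by (auto simp: kernel_def)
    have "inv a \<in> ?K" using that K by (simp add: subgroup.m_inv_closed)
    moreover have "a \<oplus> inv a = \<zero>" using a eq[of a "inv a"] one by simp
    then have "inv\<^bsub>add_monoid B\<^esub> a = inv a"
      using a A.inv_equality[of "inv a" a] A.r_inv[of a] A.inv_unique'[of a "inv a"] A.inv_comm[of a "inv a"]
      by simp
    ultimately show ?thesis by simp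
  qed
  have K': "subgroup ?K (add_monoid B)"
    using sum inv subgroup.one_closed[OF K] by (intro A.subgroupI) (auto simp: kernel_def)
  show ?thesis
    by (rule solvable_cong[OF A.subgroup_imp_group[OF K'] M.subgroup_imp_group[OF K] _ _
          A.subgroup_solvable[OF K' sol]])
      (auto simp: kernel_def eq)
qed

subsection \<open>Regular subgroups from skew braces\<close>

context skew_brace begin

interpretation A: group "add_monoid B" by (fact add_group)
interpretation M: group B by (fact mult_group)

text \<open>The usual lambda map of skew brace theory. It is restricted to the carrier because
  members of \<open>AutoGroup\<close> are extensional functions.\<close>

definition lam :: "'a \<Rightarrow> 'a \<Rightarrow> 'a"
  where "lam a = (\<lambda>b\<in>carrier B. inv\<^bsub>add_monoid B\<^esub> a \<oplus> a \<otimes> b)"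

lemma add_closed: "\<lbrakk>a \<in> carrier B; b \<in> carrier B\<rbrakk> \<Longrightarrow> a \<oplus> b \<in> carrier B"
  using A.m_closed by simp

lemma add_lam: "\<lbrakk>a \<in> carrier B; b \<in> carrier B\<rbrakk> \<Longrightarrow> a \<oplus> lam a b = a \<otimes> b"
  using A.m_assoc[of a "inv\<^bsub>add_monoid B\<^esub> a" "a \<otimes> b"] A.r_inv[of a] A.l_one[of "a \<otimes> b"]
    A.inv_closed[of a]
  by (simp add: lam_def)

lemma lam_closed: "\<lbrakk>a \<in> carrier B; b \<in> carrier B\<rbrakk> \<Longrightarrow> lam a b \<in> carrier B"
  using A.inv_closed[of a] by (simp add: lam_def add_closed)

lemma lam_eqI:
  assumes "a \<in> carrier B" "b \<in> carrier B" "c \<in> carrier B" "a \<oplus> c = a \<otimes> b"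
  shows "lam a b = c"
  using assms add_lam[of a b] A.Units_l_cancel[of a "lam a b" c] lam_closed by simp

lemma lam_add:
  assumes "a \<in> carrier B" "b \<in> carrier B" "c \<in> carrier B"
  shows "lam a (b \<oplus> c) = lam a b \<oplus> lam a c"
proof (rule lam_eqI)
  have "a \<oplus> (lam a b \<oplus> lam a c) = (a \<otimes> b) \<oplus> lam a c"
    using assms A.m_assoc[of a "lam a b" "lam a c"] by (simp add: lam_closed add_lam)
  also have "\<dots> = a \<otimes> (b \<oplus> c)"
    using assms A.inv_closed[of a] A.m_assoc[of "a \<otimes> b" "inv\<^bsub>add_monoid B\<^esub> a" "a \<otimes> c"]
    by (simp add: brace_eq a_minus_def a_inv_def lam_def)
  finally show "a \<oplus> (lam a b \<oplus> lam a c) = a \<otimes> (b \<oplus> c)" .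
qed (use assms in \<open>auto simp: lam_closed add_closed\<close>)

text \<open>Adding a \<circ> b on the left turns both sides into a \<circ> b \<circ> c; on the
  right, \<open>lam_add\<close> first merges the two values of \<open>lam a\<close>.\<close>

lemma lam_mult:
  assumes "a \<in> carrier B" "b \<in> carrier B" "c \<in> carrier B"
  shows "lam (a \<otimes> b) c = lam a (lam b c)"
proof (rule lam_eqI)
  have "(a \<otimes> b) \<oplus> lam a (lam b c) = a \<oplus> (lam a b \<oplus> lam a (lam b c))"
    using assms A.m_assoc[of a "lam a b" "lam a (lam b c)"] by (simp add: lam_closed add_lam)
  also have "\<dots> = a \<otimes> (b \<otimes> c)" using assms by (simp add: lam_closed add_lam flip: lam_add)
  finally show "(a \<otimes> b) \<oplus> lam a (lam b c) = a \<otimes> b \<otimes> c" using assms by (simp add: M.m_assoc)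
qed (use assms in \<open>auto simp: lam_closed\<close>)

lemma zero_closed: "\<zero> \<in> carrier B" using A.one_closed by simp

text \<open>An additive map fixes zero, so 1 \<circ> 0 = 1 + 0; the left side is 0 and the right
  side is 1.\<close>

lemma one_eq_zero: "\<one> = \<zero>"
proof -
  have "lam \<one> \<zero> \<oplus> lam \<one> \<zero> = lam \<one> \<zero>"
    using lam_add[of \<one> \<zero> \<zero>] zero_closed A.l_one[of \<zero>] by simp
  then have "lam \<one> \<zero> = \<zero>"
    using A.l_cancel_one[of "lam \<one> \<zero>" "lam \<one> \<zero>"] lam_closed[of \<one> \<zero>] zero_closed by simp
  then show ?thesis using add_lam[of \<one> \<zero>] zero_closed A.r_one[of \<one>] by simp
qed

lemma lam_one: "b \<in> carrier B \<Longrightarrow> lam \<one> b = b"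
  using A.l_one[of b] by (intro lam_eqI) (auto simp flip: one_eq_zero)

lemma lam_auto: "lam a \<in> carrier (AutoGroup (add_monoid B))" if a: "a \<in> carrier B"
proof -
  have "bij_betw (lam a) (carrier B) (carrier B)"
    using a lam_mult[of a "inv a"] lam_mult[of "inv a" a]
    by (intro bij_betw_byWitness[where f' = "lam (inv a)"]) (auto simp: lam_closed lam_one)
  then show ?thesis
    using a by (auto simp: AutoGroup_def auto_def hom_def Bij_def lam_closed lam_add)
      (simp add: lam_def)
qed

text \<open>The pair (a, \<open>lam a\<close>) acts on B as left multiplication by a for \<circ>, so
  R is the left regular representation of the multiplicative group, placed inside the holomorph of
  the additive one.\<close>

lemma regular_subgroup_lam:
  defines "R \<equiv> (\<lambda>a. (a, lam a)) ` carrier B"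
  shows "regular_subgroup R (add_monoid B)"
    and "B \<cong> Hol (add_monoid B)\<lparr>carrier := R\<rparr>"
    and "group (Hol (add_monoid B)\<lparr>carrier := R\<rparr>)"
proof -
  let ?H = "Hol (add_monoid B)" and ?f = "\<lambda>a. (a, lam a)"
  interpret Aut: group "AutoGroup (add_monoid B)" by (fact A.AutoGroup)
  have "(\<lambda>\<alpha>. \<alpha>) \<in> hom (AutoGroup (add_monoid B)) (AutoGroup (add_monoid B))" by (simp add: hom_def)
  then interpret H: group ?H unfolding Hol_def using A.semidirect_group Aut.is_group by blast
  have lam_comp: "lam (a \<otimes> b) = lam a \<otimes>\<^bsub>AutoGroup (add_monoid B)\<^esub> lam b"
    if "a \<in> carrier B" "b \<in> carrier B" for a b
    using that lam_auto[of a] lam_auto[of b]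
    by (auto simp: AutoGroup_def auto_def BijGroup_def compose_def fun_eq_iff lam_mult)
      (simp add: lam_def)
  have f: "?f \<in> hom B ?H"
    by (auto simp: hom_def Hol_def semidirect_def lam_auto lam_comp add_lam)
  interpret f: group_hom B ?H ?f using f by unfold_locales
  have sub: "subgroup R ?H" unfolding R_def by (rule f.img_is_subgroup)
  have one: "\<one>\<^bsub>?H\<^esub> = ?f \<one>" using f.hom_one by simp
  have act: "hol_act (add_monoid B) (?f a) x = a \<otimes> x" if "a \<in> carrier B" "x \<in> carrier B" for a x
    using that by (simp add: hol_act_def add_lam)
  have free: "\<forall>g\<in>R. \<forall>x\<in>carrier (add_monoid B). hol_act (add_monoid B) g x = x \<longrightarrow> g = \<one>\<^bsub>?H\<^esub>"
    unfolding R_def one using act M.r_cancel_one by auto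
  have trans: "\<forall>x\<in>carrier (add_monoid B). \<forall>y\<in>carrier (add_monoid B). \<exists>g\<in>R. hol_act (add_monoid B) g x = y"
  proof (intro ballI)
    fix x y assume "x \<in> carrier (add_monoid B)" "y \<in> carrier (add_monoid B)"
    then have xy: "x \<in> carrier B" "y \<in> carrier B" by auto
    then show "\<exists>g\<in>R. hol_act (add_monoid B) g x = y"
      unfolding R_def using act[of "y \<otimes> inv x" x]
      by (intro bexI[OF _ imageI[of "y \<otimes> inv x"]]) (simp_all add: M.m_assoc del: f.hom_mult)
  qed
  show "regular_subgroup R (add_monoid B)"
    using sub free trans by (simp add: regular_subgroup_def)
  have "?f \<in> iso B (?H\<lparr>carrier := R\<rparr>)"
    using f by (auto simp: iso_def hom_def R_def bij_betw_def inj_on_def)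
  then show "B \<cong> ?H\<lparr>carrier := R\<rparr>" by (rule is_isoI)
  show "group (?H\<lparr>carrier := R\<rparr>)" using sub by (rule H.subgroup_imp_group)
qed

end

subsection \<open>Arithmetic modulo 2, 3 and 7\<close>

lemma exhaust_mod_2: "x \<in> {0, 1}" for x :: 2
proof -
  obtain z where "x = of_int z" "0 \<le> z" "z < 2" by (cases x) auto
  moreover from this have "z \<in> {0, 1}" by auto
  ultimately show ?thesis by auto
qed

lemma exhaust_mod_3: "x \<in> {0, 1, 2}" for x :: 3
proof -
  obtain z where "x = of_int z" "0 \<le> z" "z < 3" by (cases x) auto
  moreover from this have "z \<in> {0, 1, 2}" by auto
  ultimately show ?thesis by auto
qed

lemma exhaust_mod_7: "x \<in> {0, 1, 2, 3, 4, 5, 6}" for x :: 7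
proof -
  obtain z where "x = of_int z" "0 \<le> z" "z < 7" by (cases x) auto
  moreover from this have "z \<in> {0, 1, 2, 3, 4, 5, 6}" by auto
  ultimately show ?thesis by auto
qed

lemma all_mod_2: "(\<forall>x::2. P x) \<longleftrightarrow> P 0 \<and> P 1"
  using exhaust_mod_2 by (metis empty_iff insert_iff)

lemma all_mod_3: "(\<forall>x::3. P x) \<longleftrightarrow> P 0 \<and> P 1 \<and> P 2"
  using exhaust_mod_3 by (metis empty_iff insert_iff)

lemma all_mod_7: "(\<forall>x::7. P x) \<longleftrightarrow> P 0 \<and> P 1 \<and> P 2 \<and> P 3 \<and> P 4 \<and> P 5 \<and> P 6"
  using exhaust_mod_7 by (metis empty_iff insert_iff)

lemma add_self_mod_2 [simp]: "x + x = 0" for x :: 2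
proof -
  have "\<forall>x::2. x + x = 0" unfolding all_mod_2 by simp
  then show ?thesis by blast
qed

lemma add_self_vec_mod_2 [simp]: "a + a = 0" for a :: "2^'n"
  by (simp only: vec_eq_iff vector_add_component add_self_mod_2 zero_index simp_thms)

text \<open>By Fermat, the fifth power serves as the inverse of a nonzero element from here on; at 0
  it takes the value 0.\<close>

lemma inverse_mod_7: "x \<noteq> 0 \<Longrightarrow> x * x ^ 5 = 1" for x :: 7
proof -
  have "\<forall>x::7. x \<noteq> 0 \<longrightarrow> x * x ^ 5 = 1" unfolding all_mod_7 by simp
  then show "x \<noteq> 0 \<Longrightarrow> x * x ^ 5 = 1" by blast
qed

lemma mult_eq_0_mod_7: "x * y = 0 \<longleftrightarrow> x = 0 \<or> y = 0" for x y :: 7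
proof
  assume xy: "x * y = 0"
  have "y = 0" if "x \<noteq> 0"
  proof -
    from that have "y = (x * x ^ 5) * y" by (subst inverse_mod_7) simp_all
    also have "\<dots> = x ^ 5 * (x * y)" by (simp only: mult_ac)
    finally show "y = 0" using xy by simp
  qed
  then show "x = 0 \<or> y = 0" by blast
qed auto

lemma power5_eq_0_mod_7 [simp]: "x ^ 5 = 0 \<longleftrightarrow> x = 0" for x :: 7
  using inverse_mod_7[of x] by (cases "x = 0") auto

lemma square_eq_1_mod_7: "x ^ 2 = 1 \<longleftrightarrow> x = 1 \<or> x = -1" for x :: 7
proof -
  have "x ^ 2 = 1 \<longleftrightarrow> (x - 1) * (x + 1) = 0" by (simp add: algebra_simps power2_eq_square)
  then show ?thesis by (simp add: mult_eq_0_mod_7 eq_neg_iff_add_eq_0)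
qed

subsection \<open>\<open>SL\<^sub>2(7)\<close> acting on the projective line\<close>

type_synonym pt = "7 option"

definition mat2 :: "7 \<Rightarrow> 7 \<Rightarrow> 7 \<Rightarrow> 7 \<Rightarrow> 7^2^2"
  where "mat2 a b c d = vector [vector [a, b], vector [c, d]]"

lemma mat2_nth [simp]: "mat2 a b c d $ 1 $ 1 = a" "mat2 a b c d $ 1 $ 2 = b"
  "mat2 a b c d $ 2 $ 1 = c" "mat2 a b c d $ 2 $ 2 = d"
  by (simp_all add: mat2_def)

lemma mat2_eq_iff: "g = h \<longleftrightarrow> g$1$1 = h$1$1 \<and> g$1$2 = h$1$2 \<and> g$2$1 = h$2$1 \<and> g$2$2 = h$2$2"
  for g h :: "7^2^2"
  by (auto simp: vec_eq_iff forall_2)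

lemma mult2_nth [simp]: "(g ** h)$i$j = g$i$1 * h$1$j + g$i$2 * h$2$j" for g h :: "7^2^2"
  by (simp add: matrix_matrix_mult_def sum_2)

lemma mat_1_nth [simp]: "(mat 1 :: 7^2^2)$1$1 = 1" "(mat 1 :: 7^2^2)$1$2 = 0"
  "(mat 1 :: 7^2^2)$2$1 = 0" "(mat 1 :: 7^2^2)$2$2 = 1"
  by (simp_all add: mat_def)

definition adj2 :: "7^2^2 \<Rightarrow> 7^2^2"
  where "adj2 g = mat2 (g$2$2) (- g$1$2) (- g$2$1) (g$1$1)"

lemma det_adj2: "det (adj2 g) = det g"
  by (simp add: det_2 adj2_def)

lemma adj2:
  assumes "det g = 1"
  shows "adj2 g ** g = mat 1" "g ** adj2 g = mat 1"
  using assms by (simp_all add: det_2 mat2_eq_iff adj2_def algebra_simps)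

lemma carrier_SL: "carrier (SL :: (7^2^2) monoid) = {g. det g = 1}"
  unfolding SL_def GL_def using adj2 by (auto simp: invertible_def)

lemma SL_simps [simp]: "mult (SL :: (7^2^2) monoid) = (**)" "one (SL :: (7^2^2) monoid) = mat 1"
  by (simp_all add: SL_def GL_def)

lemma group_SL: "group (SL :: (7^2^2) monoid)"
proof (rule groupI)
  fix g :: "7^2^2" assume "g \<in> carrier SL"
  then show "\<exists>h\<in>carrier SL. h \<otimes>\<^bsub>SL\<^esub> g = \<one>\<^bsub>SL\<^esub>"
    by (intro bexI[of _ "adj2 g"]) (auto simp: carrier_SL adj2 det_adj2)
qed (auto simp: carrier_SL det_mul matrix_mul_assoc)

abbreviation trans2 :: "7 \<Rightarrow> 7^2^2" where "trans2 x \<equiv> mat2 1 x 0 1"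
abbreviation weyl2 :: "7^2^2" where "weyl2 \<equiv> mat2 0 (-1) 1 0"

text \<open>The matrices \<open>trans2 1\<close> and \<open>weyl2\<close> have finite order, so they
  generate the group under products alone and P need not be known to respect inverses.\<close>

lemma SL2_induct:
  assumes det: "det g = 1"
    and mult: "\<And>g h. \<lbrakk>P g; P h; det g = 1; det h = 1\<rbrakk> \<Longrightarrow> P (g ** h)"
    and T: "P (trans2 1)" and S: "P weyl2"
  shows "P g"
proof -
  have T_nat: "P (trans2 (of_nat (Suc n)))" for n
  proof (induction n)
    case (Suc n)
    have "trans2 (of_nat (Suc (Suc n))) = trans2 (of_nat (Suc n)) ** trans2 1"
      by (simp add: mat2_eq_iff)
    then show ?case using mult[OF Suc T] by (simp add: det_2)
  qed (use T in simp)
  have T: "P (trans2 x)" for x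
  proof -
    \<comment> \<open>\<open>T_nat\<close> covers positive exponents only; the parameter 0 is
      reached as the seventh power.\<close>
    have "of_nat (Suc 6) = (0::7)" by simp
    from T_nat[of 6, unfolded this] have "\<forall>x. P (trans2 x)"
      unfolding all_mod_7
      using T_nat[of 0] T_nat[of 1] T_nat[of 2] T_nat[of 3] T_nat[of 4] T_nat[of 5] by simp
    then show ?thesis by blast
  qed
  have S2: "P (weyl2 ** weyl2)" "det (weyl2 ** weyl2) = 1" using mult[OF S S] by (simp_all add: det_2)
  have S3: "P (weyl2 ** weyl2 ** weyl2)" using mult[OF S2(1) S S2(2)] by (simp add: det_2)
  have L: "P (mat2 1 0 x 1)" for x
  proof -
    \<comment> \<open>The cube of \<open>weyl2\<close> is its inverse, so this is a conjugate of an
      upper transvection.\<close>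
    have "mat2 1 0 x 1 = weyl2 ** trans2 (-x) ** (weyl2 ** weyl2 ** weyl2)"
      by (simp add: mat2_eq_iff)
    moreover have "P (weyl2 ** trans2 (-x))" using mult[OF S T] by (simp add: det_2)
    ultimately show ?thesis using mult[OF _ S3] by (simp add: det_2)
  qed
  \<comment> \<open>A matrix with nonzero lower left entry is a product of three transvections.\<close>
  have lower: "P g" if "det g = 1" "g$2$1 \<noteq> 0" for g
  proof -
    let ?c = "g$2$1" let ?r = "?c ^ 5"
    have r: "?c * ?r = 1" using that by (simp add: inverse_mod_7)
    have cancel: "u * ?r * ?c = u" for u
      using r by (simp only: mult.assoc mult.commute[of ?r] mult_1_right)
    obtain p where p: "p * ?c = g$1$1 - 1" using cancel by blast
    obtain q where q: "?c * q = g$2$2 - 1" using cancel mult.commute by metis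
    have "g = trans2 p ** mat2 1 0 ?c 1 ** trans2 q" (is "g = ?x ** ?y ** ?z")
    proof -
      \<comment> \<open>The choice of p and q matches the diagonal entries; the upper right entry is
        then forced by the determinant.\<close>
      have "(?x ** ?y ** ?z)$1$2 * ?c = (1 + p * ?c) * (?c * q) + p * ?c"
        by (simp add: algebra_simps)
      also have "\<dots> = g$1$1 * g$2$2 - 1" unfolding p q by (simp add: algebra_simps)
      also have "\<dots> = g$1$2 * ?c" using that by (simp add: det_2 algebra_simps)
      finally have "(?x ** ?y ** ?z)$1$2 * ?c * ?r = g$1$2 * ?c * ?r" by simp
      then have "(?x ** ?y ** ?z)$1$2 = g$1$2" using r by (simp only: mult.assoc mult_1_right)
      then show ?thesis using p q unfolding mat2_eq_iff by simp
    qed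
    moreover have "P (?x ** ?y)" using mult[OF T L] by (simp add: det_2)
    then have "P (?x ** ?y ** ?z)" using mult[OF _ T] by (simp add: det_2)
    ultimately show ?thesis by metis
  qed
  show ?thesis
  proof (cases "g$2$1 = 0")
    case True
    \<comment> \<open>Multiplying by the inverse of \<open>weyl2\<close> moves the nonzero upper
      left entry, negated, to the lower left.\<close>
    let ?h = "(weyl2 ** weyl2 ** weyl2) ** g"
    have g: "g = weyl2 ** ?h" by (simp add: mat2_eq_iff)
    have "g$1$1 \<noteq> 0" using det True by (auto simp: det_2)
    then have "P ?h" using det True by (intro lower) (auto simp: det_2 mult.commute)
    then show ?thesis using det True by (subst g, intro mult[OF S]) (auto simp: det_2 mult.commute)
  qed (use lower det in blast)
qed

section \<open>Moebius maps in homogeneous coordinates, with \<open>None\<close> as infinity\<close>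

definition col :: "pt \<Rightarrow> 7^2"
  where "col i = (case i of None \<Rightarrow> vector [1, 0] | Some k \<Rightarrow> vector [k, 1])"

definition point :: "7^2 \<Rightarrow> pt"
  where "point v = (if v$2 = 0 then None else Some (v$1 * (v$2) ^ 5))"

definition moebius :: "7^2^2 \<Rightarrow> pt \<Rightarrow> pt"
  where "moebius g i = point (g *v col i)"

text \<open>A fixed choice, for every point, of a matrix of determinant 1 carrying infinity to it;
  these are coset representatives of the stabiliser of infinity.\<close>

definition frame :: "pt \<Rightarrow> 7^2^2"
  where "frame i = (case i of None \<Rightarrow> mat 1 | Some k \<Rightarrow> mat2 k (-1) 1 0)"

lemma mult_vec2_nth: "(g *v v)$i = g$i$1 * v$1 + g$i$2 * v$2" for v :: "7^2"
  by (simp add: matrix_vector_mult_def sum_2)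

lemma mult_vec2_scale: "g *v (s *s v) = s *s (g *v v)" for v :: "7^2"
  by (simp add: vec_eq_iff mult_vec2_nth algebra_simps)

lemma det_frame [simp]: "det (frame i) = 1"
  by (cases i) (simp_all add: frame_def det_2)

lemma point_col [simp]: "point (col i) = i"
  by (cases i) (auto simp: point_def col_def)

lemma col_point:
  assumes "v \<noteq> 0"
  obtains s where "s \<noteq> 0" "v = s *s col (point v)"
proof (cases "v$2 = 0")
  case True
  then have "v$1 \<noteq> 0" using assms by (auto simp: vec_eq_iff forall_2)
  with True show ?thesis
    by (intro that[of "v$1"]) (auto simp: vec_eq_iff forall_2 point_def col_def)
next
  case False
  then show ?thesis using inverse_mod_7[OF False]
    by (intro that[of "v$2"]) (auto simp: vec_eq_iff forall_2 point_def col_def algebra_simps)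
qed

lemma point_scale: "s \<noteq> 0 \<Longrightarrow> point (s *s v) = point v"
proof -
  assume s: "s \<noteq> 0"
  have "s * v$1 * (s * v$2) ^ 5 = (s * s ^ 5) * (v$1 * (v$2) ^ 5)"
    by (simp only: power_mult_distrib mult_ac)
  then show ?thesis using s by (simp add: point_def mult_eq_0_mod_7 inverse_mod_7)
qed

lemma col_nonzero: "col i \<noteq> 0"
  by (cases i) (auto simp: col_def vec_eq_iff forall_2)

lemma det_1_mult_nonzero: "\<lbrakk>det g = 1; v \<noteq> 0\<rbrakk> \<Longrightarrow> g *v v \<noteq> 0" for g :: "7^2^2"
  using adj2[of g] by (metis matrix_vector_mul_assoc matrix_vector_mul_lid matrix_vector_mult_0_right)

lemma moebius_scale:
  assumes "det g = 1"
  obtains s where "s \<noteq> 0" "g *v col i = s *s col (moebius g i)"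
  using col_point[OF det_1_mult_nonzero[OF assms col_nonzero[of i]]] unfolding moebius_def by blast

lemma moebius_mult:
  assumes "det h = 1"
  shows "moebius (g ** h) i = moebius g (moebius h i)"
proof -
  obtain s where s: "s \<noteq> 0" "h *v col i = s *s col (moebius h i)" using moebius_scale[OF assms] .
  have "moebius (g ** h) i = point (g *v (h *v col i))"
    by (simp add: moebius_def matrix_vector_mul_assoc)
  also have "\<dots> = point (s *s (g *v col (moebius h i)))"
    unfolding s(2) by (simp add: mult_vec2_scale)
  finally show ?thesis using s(1) by (simp add: point_scale moebius_def)
qed

lemma moebius_one [simp]: "moebius (mat 1) i = i"
  by (simp add: moebius_def)

lemma frame_col: "frame i *v col None = col i"
  by (cases i) (simp_all add: frame_def col_def vec_eq_iff forall_2 mult_vec2_nth)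

lemma moebius_frame [simp]: "moebius (frame i) None = i"
  by (simp add: moebius_def frame_col)

text \<open>
  The fibre over a point \<open>i\<close> is the set of points other than \<open>i\<close>, with the affine coordinate
  for which \<open>x\<close> stands for \<open>frame i\<close> applied to \<open>x\<close>. In these coordinates \<open>g\<close> maps the fibre
  over \<open>i\<close> to the fibre over \<open>g i\<close> by the upper triangular matrix \<open>cocycle g i\<close>.
\<close>

definition cocycle :: "7^2^2 \<Rightarrow> pt \<Rightarrow> 7^2^2"
  where "cocycle g i = adj2 (frame (moebius g i)) ** g ** frame i"

text \<open>For an upper triangular matrix of determinant 1 the lower right entry is the inverse of
  the upper left one, so its Moebius map takes this form without division.\<close>

definition borel :: "7^2^2 \<Rightarrow> 7 \<Rightarrow> 7"
  where "borel b x = b$1$1 * b$1$2 + (b$1$1)^2 * x"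

definition flag_act :: "7^2^2 \<Rightarrow> pt \<times> 7 \<Rightarrow> pt \<times> 7"
  where "flag_act g = (\<lambda>(i, x). (moebius g i, borel (cocycle g i) x))"

lemma det_cocycle: "det g = 1 \<Longrightarrow> det (cocycle g i) = 1"
  by (simp add: cocycle_def det_mul det_adj2)

text \<open>The frames carry infinity to i and the image of i back to infinity, so
  \<open>cocycle g i\<close> fixes the line spanned by \<open>col None\<close>.\<close>

lemma cocycle_triangular:
  assumes "det g = 1"
  shows "(cocycle g i)$2$1 = 0"
proof -
  obtain s where s: "g *v col i = s *s col (moebius g i)" using moebius_scale[OF assms] .
  have "cocycle g i *v col None = adj2 (frame (moebius g i)) *v (g *v col i)"
    by (simp add: cocycle_def frame_col flip: matrix_vector_mul_assoc)
  also have "\<dots> = s *s (adj2 (frame (moebius g i)) *v (frame (moebius g i) *v col None))"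
    unfolding s by (simp add: mult_vec2_scale frame_col)
  also have "\<dots> = s *s col None" by (simp add: matrix_vector_mul_assoc adj2)
  finally show ?thesis by (simp add: vec_eq_iff forall_2 mult_vec2_nth col_def)
qed

lemma cocycle_mult:
  assumes "det h = 1"
  shows "cocycle (g ** h) i = cocycle g (moebius h i) ** cocycle h i"
proof -
  have "cocycle g (moebius h i) ** cocycle h i = adj2 (frame (moebius g (moebius h i))) ** g **
      (frame (moebius h i) ** adj2 (frame (moebius h i))) ** h ** frame i"
    by (simp only: cocycle_def matrix_mul_assoc)
  then show ?thesis
    using assms by (simp add: adj2 cocycle_def moebius_mult matrix_mul_assoc)
qed

lemma borel_mult:
  assumes "det c = 1" "c$2$1 = 0"
  shows "borel (b ** c) x = borel b (borel c x)"
proof -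
  have "borel (b ** c) x =
      b$1$1 * b$1$2 * (c$1$1 * c$2$2) + (b$1$1)^2 * (c$1$1 * c$1$2 + (c$1$1)^2 * x)"
    using assms(2) by (simp add: borel_def algebra_simps power2_eq_square)
  also have "c$1$1 * c$2$2 = 1" using assms by (simp add: det_2)
  finally show ?thesis by (simp add: borel_def)
qed

lemma flag_act_mult:
  assumes "det h = 1"
  shows "flag_act (g ** h) = flag_act g \<circ> flag_act h"
  using assms
  by (auto simp: flag_act_def fun_eq_iff moebius_mult cocycle_mult borel_mult det_cocycle cocycle_triangular)

lemma flag_act_one: "flag_act (mat 1) = id"
  by (simp add: flag_act_def fun_eq_iff cocycle_def adj2 borel_def)

lemma flag_act_None: "moebius g None = None \<Longrightarrow> flag_act g (None, x) = (None, borel g x)"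
  by (simp add: flag_act_def cocycle_def) (simp add: frame_def adj2_def borel_def)

lemma flag_act_frame: "flag_act (frame i) (None, x) = (i, x)"
  by (simp add: flag_act_def cocycle_def adj2) (simp add: frame_def borel_def)

lemma flag_act_minus_one: "flag_act (- mat 1) = id"
proof -
  have "moebius (- mat 1) i = i" for i
  proof -
    have "(- mat 1 :: 7^2^2) *v col i = (-1) *s col i"
      by (simp add: vec_eq_iff forall_2 mult_vec2_nth)
    then show ?thesis by (simp add: moebius_def point_scale)
  qed
  moreover have "cocycle g i = - mat 1" if "g = - mat 1" "moebius g i = i" for g i
    using that by (cases i) (simp_all add: cocycle_def frame_def adj2_def mat2_eq_iff)
  ultimately show ?thesis by (simp add: flag_act_def fun_eq_iff borel_def)
qed

text \<open>Fixing infinity makes g upper triangular. Slope 1 and offset 0 on the fibre then leave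
  only a sign. This will give X \<inter> Y = 1.\<close>

lemma fixes_flags_None:
  assumes "det g = 1" "\<And>x. flag_act g (None, x) = (None, x)"
  shows "g = mat 1 \<or> g = - mat 1"
proof -
  have fixed: "moebius g None = None" using assms(2)[of 0] by (simp add: flag_act_def)
  then have 21: "g$2$1 = 0"
    by (auto simp: moebius_def point_def col_def mult_vec2_nth split: if_splits)
  have "borel g 0 = 0" "borel g 1 = 1" using assms(2) flag_act_None[OF fixed] by auto
  then have "(g$1$1)^2 = 1" "g$1$1 * g$1$2 = 0" by (auto simp: borel_def)
  moreover have "g$1$1 * g$2$2 = 1" using assms(1) 21 by (simp add: det_2)
  moreover have "g$2$2 = -1" if "- g$2$2 = 1" using that by (simp add: minus_equation_iff[of _ 1])
  ultimately show ?thesis using 21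
    unfolding square_eq_1_mod_7 mat2_eq_iff by (elim disjE) simp_all
qed

subsection \<open>The affine structure of the projective line\<close>

text \<open>
  Labels the projective line by \<open>\<^bold>F\<^sub>8 = \<^bold>F\<^sub>2[\<theta>]\<close> with \<open>\<theta>\<^sup>3 = \<theta> + 1\<close>: \<open>\<infinity>\<close> has label \<open>0\<close> and
  \<open>k\<close> has label \<open>\<theta>\<^sup>k\<close>. Then \<open>x \<mapsto> x + 1\<close> is multiplication by \<open>\<theta>\<close>, and \<open>x \<mapsto> -1/x\<close> turns out
  to be affine over \<open>\<^bold>F\<^sub>2\<close> as well.
\<close>

definition label :: "pt \<Rightarrow> 2^3"
  where "label i = (case i of None \<Rightarrow> 0 | Some k \<Rightarrow>
    if k = 0 then vector [1, 0, 0] else if k = 1 then vector [0, 1, 0]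
    else if k = 2 then vector [0, 0, 1] else if k = 3 then vector [1, 1, 0]
    else if k = 4 then vector [0, 1, 1] else if k = 5 then vector [1, 1, 1]
    else vector [1, 0, 1])"

lemma all_pt: "(\<forall>i::pt. P i) \<longleftrightarrow> P None \<and> P (Some 0) \<and> P (Some 1) \<and> P (Some 2) \<and> P (Some 3)
    \<and> P (Some 4) \<and> P (Some 5) \<and> P (Some 6)"
  by (metis all_mod_7[of "\<lambda>k. P (Some k)"] option.exhaust)

lemma vec3_eq_iff: "a = b \<longleftrightarrow> a$1 = b$1 \<and> a$2 = b$2 \<and> a$3 = b$3" for a b :: "'a^3"
  by (auto simp: vec_eq_iff forall_3)

lemma inj_label: "inj label"
proof -
  have "\<forall>i j. label i = label j \<longrightarrow> i = j"
    unfolding all_pt by (simp add: label_def vec3_eq_iff)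
  then show ?thesis by (auto simp: inj_def)
qed

lemma bij_label: "bij label"
proof -
  have "card (range label) = CARD(pt)" by (rule card_image) (rule inj_label)
  also have "\<dots> = CARD(2^3)" by (simp add: card_UNIV_option)
  finally have "range label = UNIV" by (intro card_subset_eq) auto
  then show ?thesis using inj_label by (simp add: bij_def)
qed

definition shift :: "2^3 \<Rightarrow> pt \<Rightarrow> pt"
  where "shift a i = inv_into UNIV label (label i + a)"

lemma label_shift [simp]: "label (shift a i) = label i + a"
  by (simp add: shift_def bij_label bij_is_surj surj_f_inv_f)

lemma shift_eqI: "label j = label i + a \<Longrightarrow> shift a i = j"
  by (metis inj_label injD label_shift)

lemma shift_0 [simp]: "shift 0 i = i"
  by (rule shift_eqI) simp

lemma shift_add: "shift (a + b) i = shift a (shift b i)"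
  by (rule shift_eqI) (simp add: add_ac)

lemma shift_shift [simp]: "shift a (shift a i) = i"
  by (simp flip: shift_add)

lemma ex_shift: "\<exists>a. shift a i = j"
  by (rule exI[of _ "label i + label j"], rule shift_eqI) (simp flip: add.assoc)

lemma bij_shift: "bij (shift a)"
  by (rule o_bij[of "shift a"]) (auto simp: fun_eq_iff)

lemma shift_cancel: "shift a i = shift b i \<Longrightarrow> a = b"
  by (metis add_left_imp_eq label_shift)

text \<open>Affineness is expressed by how g conjugates translations, so the translation part of g
  never has to be carried along.\<close>

definition linear_part :: "7^2^2 \<Rightarrow> 2^3^3 \<Rightarrow> bool"
  where "linear_part g L \<longleftrightarrow> (\<forall>a i. moebius g (shift a i) = shift (L *v a) (moebius g i))"

lemma linear_partI:
  assumes "\<forall>i. label (moebius g i) = L *v label i + t"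
  shows "linear_part g L"
  using assms
  by (auto simp: linear_part_def matrix_vector_right_distrib add_ac intro!: shift_eqI[symmetric])

lemma linear_part_mult:
  assumes "linear_part g L" "linear_part h M" "det h = 1"
  shows "linear_part (g ** h) (L ** M)"
  using assms by (simp add: linear_part_def moebius_mult matrix_vector_mul_assoc)

lemma mult_vec3_nth: "(A *v v)$i = A$i$1 * v$1 + A$i$2 * v$2 + A$i$3 * v$3" for v :: "'a::comm_ring_1^3"
  by (simp add: matrix_vector_mult_def sum_3)

lemma linear_part_trans: "\<exists>L. linear_part (trans2 1) L"
proof
  \<comment> \<open>Multiplication by \<theta> in the basis 1, \<theta>, \<theta>^2; its last column
    is \<theta>^3 = 1 + \<theta>.\<close>
  let ?L = "vector [vector [0, 0, 1], vector [1, 0, 1], vector [0, 1, 0]] :: 2^3^3"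
  have trans: "moebius (trans2 1) i = map_option (\<lambda>k. k + 1) i" for i
    by (cases i) (simp_all add: moebius_def point_def col_def mult_vec2_nth)
  have "\<forall>i. label (moebius (trans2 1) i) = ?L *v label i + 0"
    unfolding all_pt trans by (simp add: label_def vec3_eq_iff mult_vec3_nth)
  then show "linear_part (trans2 1) ?L" by (rule linear_partI)
qed

lemma linear_part_weyl: "\<exists>L. linear_part weyl2 L"
proof
  \<comment> \<open>The translation part is the label of 0, the image of infinity. The columns are
    read off at the points 0, 1, 2, whose labels are the unit vectors; the other four points are a
    genuine check.\<close>
  let ?L = "vector [vector [1, 0, 0], vector [0, 0, 1], vector [0, 1, 0]] :: 2^3^3"
  have "\<forall>i. label (moebius weyl2 i) = ?L *v label i + vector [1, 0, 0]"
    unfolding all_pt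
    by (simp add: moebius_def point_def col_def mult_vec2_nth)
      (simp add: label_def vec3_eq_iff mult_vec3_nth)
  then show "linear_part weyl2 ?L" by (rule linear_partI)
qed

lemma ex_linear_part: "det g = 1 \<Longrightarrow> \<exists>L. linear_part g L"
  by (rule SL2_induct[of g "\<lambda>g. \<exists>L. linear_part g L"])
    (use linear_part_mult linear_part_trans linear_part_weyl in blast)+

lemma linear_part_unique: "\<lbrakk>linear_part g L; linear_part g M\<rbrakk> \<Longrightarrow> L = M"
  unfolding linear_part_def matrix_eq by (metis shift_cancel)

definition lin :: "7^2^2 \<Rightarrow> 2^3^3"
  where "lin g = (THE L. linear_part g L)"

lemma lin_eqI: "linear_part g L \<Longrightarrow> lin g = L"
  unfolding lin_def using linear_part_unique by blast

lemma moebius_shift: "det g = 1 \<Longrightarrow> moebius g (shift a i) = shift (lin g *v a) (moebius g i)"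
  using ex_linear_part[of g] lin_eqI[of g] by (auto simp: linear_part_def)

lemma linear_part_lin: "det g = 1 \<Longrightarrow> linear_part g (lin g)"
  using ex_linear_part[of g] lin_eqI[of g] by auto

lemma lin_mult: "\<lbrakk>det g = 1; det h = 1\<rbrakk> \<Longrightarrow> lin (g ** h) = lin g ** lin h"
  by (intro lin_eqI linear_part_mult linear_part_lin)

lemma lin_one [simp]: "lin (mat 1) = mat 1"
  by (rule lin_eqI) (simp add: linear_part_def)

lemma moebius_trivial:
  assumes "det g = 1" "\<And>i. moebius g i = i"
  shows "g = mat 1 \<or> g = - mat 1"
proof -
  have 21: "g$2$1 = 0" using assms(2)[of None]
    by (auto simp: moebius_def point_def col_def mult_vec2_nth split: if_splits)
  have 12: "g$1$2 = 0" using assms(2)[of "Some 0"]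
    by (auto simp: moebius_def point_def col_def mult_vec2_nth mult_eq_0_mod_7 split: if_splits)
  have det: "g$1$1 * g$2$2 = 1" using assms(1) 21 by (simp add: det_2)
  have "g$1$1 * (g$2$2)^5 = 1" using assms(2)[of "Some 1"] 21 12
    by (auto simp: moebius_def point_def col_def mult_vec2_nth split: if_splits)
  moreover have "g$2$2 * (g$2$2)^5 = 1" using det by (intro inverse_mod_7) auto
  moreover have "g$1$1 * (g$2$2 * (g$2$2)^5) = g$2$2 * (g$1$1 * (g$2$2)^5)"
    by (simp only: mult_ac)
  ultimately have eq: "g$1$1 = g$2$2" by simp
  then have "(g$2$2)^2 = 1" using det by (simp add: power2_eq_square)
  then show ?thesis using eq 12 21 by (auto simp: square_eq_1_mod_7 mat2_eq_iff)
qed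

text \<open>
  An element acting as a translation without fixed points could be conjugated to one exchanging
  \<open>\<infinity>\<close> and \<open>0\<close>, that is to \<open>x \<mapsto> c / x\<close>; but no such map agrees with the translation by \<open>\<theta>\<^sup>0\<close>
  both at \<open>1\<close> and at \<open>2\<close>.
\<close>

lemma moebius_translation:
  assumes g: "det g = 1" and lin: "lin g = mat 1"
  shows "g = mat 1 \<or> g = - mat 1"
proof (cases "moebius g None")
  case None
  have "moebius g i = i" for i
  proof -
    obtain a where a: "shift a None = i" using ex_shift by blast
    have "moebius g (shift a None) = shift a None" using g lin None by (simp add: moebius_shift)
    with a show ?thesis by simp
  qed
  with g show ?thesis by (rule moebius_trivial)
next
  case (Some k)
  define h where "h = trans2 (-k) ** g ** trans2 k"
  have det: "det h = 1" using g by (simp add: h_def det_mul) (simp add: det_2)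
  have "trans2 (-k) ** trans2 k = mat 1" by (simp add: mat2_eq_iff)
  then have "lin (trans2 (-k)) ** lin (trans2 k) = mat 1"
    by (metis lin_mult lin_one det_2 mat2_nth mult_1 mult_zero_right diff_zero)
  then have "lin h = mat 1"
    using g lin by (simp add: h_def lin_mult det_mul det_2[of "mat2 _ _ _ _"])
  then have h: "moebius h (shift a i) = shift a (moebius h i)" for a i
    using det by (simp add: moebius_shift)
  have None: "moebius h None = Some 0"
  proof -
    have "moebius (trans2 k) None = None" "moebius (trans2 (-k)) (Some k) = Some 0"
      by (simp_all add: moebius_def point_def col_def mult_vec2_nth)
    then show ?thesis using Some g
      by (simp add: h_def moebius_mult det_mul det_2[of "mat2 _ _ _ _"])
  qed
  let ?a = "vector [1, 0, 0] :: 2^3"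
  have shifts: "shift ?a None = Some 0" "shift ?a (Some 0) = None" "shift ?a (Some 1) = Some 3"
    "shift ?a (Some 2) = Some 6"
    by (rule shift_eqI, simp add: label_def vec3_eq_iff)+
  \<comment> \<open>As h commutes with the transitive group of translations and agrees with one of
    them at infinity, it agrees with it everywhere.\<close>
  have eq: "moebius h i = shift ?a i" for i
  proof -
    obtain b where "shift b None = i" using ex_shift by blast
    then show ?thesis using h[of b None] None shifts(1)
      by (metis add.commute shift_add)
  qed
  have "h$1$1 = 0" "h$2$1 \<noteq> 0" using eq[of None] shifts(1) inverse_mod_7[of "h$2$1"]
    by (auto simp: moebius_def point_def col_def mult_vec2_nth mult_eq_0_mod_7 split: if_splits)
  moreover have "h$2$2 = 0" using eq[of "Some 0"] shifts(2)
    by (auto simp: moebius_def point_def col_def mult_vec2_nth split: if_splits)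
  ultimately have "h$1$2 * (h$2$1)^5 = 3" "h$1$2 * (h$2$1 * 2)^5 = 6"
    using eq[of "Some 1"] eq[of "Some 2"] shifts
    by (auto simp: moebius_def point_def col_def mult_vec2_nth mult_eq_0_mod_7 split: if_splits)
  moreover have "h$1$2 * (h$2$1 * 2)^5 = 2 ^ 5 * (h$1$2 * (h$2$1)^5)"
    by (simp only: power_mult_distrib mult_ac)
  \<comment> \<open>This is absurd, since 96 is 5 modulo 7.\<close>
  ultimately have "2 ^ 5 * 3 = (6::7)" by simp
  then show ?thesis by simp
qed

subsection \<open>The soluble group\<close>

text \<open>Eight exponents of sum 0 are encoded by the seven at finite points; the one at infinity
  is recovered from the sum.\<close>

definition wext :: "3^7 \<Rightarrow> pt \<Rightarrow> 3"
  where "wext w i = (case i of None \<Rightarrow> - (\<Sum>k\<in>UNIV. w$k) | Some k \<Rightarrow> w$k)"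

lemma sum_pt: "(\<Sum>i\<in>UNIV. f i) = f None + (\<Sum>k\<in>UNIV. f (Some k))" for f :: "pt \<Rightarrow> 'a::comm_monoid_add"
  by (simp add: UNIV_option_conv sum.reindex)

lemma sum_wext: "(\<Sum>i\<in>UNIV. wext w i) = 0"
  by (simp add: sum_pt wext_def)

lemma wext_vec: "(\<Sum>i\<in>UNIV. f i) = 0 \<Longrightarrow> wext (\<chi> k. f (Some k)) = f"
  by (auto simp: fun_eq_iff wext_def sum_pt neg_eq_iff_add_eq_0 add.commute split: option.split)

lemma wext_add [simp]: "wext (v + w) i = wext v i + wext w i"
  by (auto simp: wext_def sum.distrib split: option.split)

lemma wext_0 [simp]: "wext 0 i = 0"
  by (auto simp: wext_def split: option.split)

lemma wext_inject: "wext v = wext w \<Longrightarrow> v = w"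
  unfolding vec_eq_iff by (metis option.simps(5) wext_def)

text \<open>A permutation of the eight exponents preserves their sum. Each \<open>shift a\<close> is
  an involution, so substituting it without inversion still gives a left action.\<close>

definition act3 :: "2^3 \<Rightarrow> 3^7 \<Rightarrow> 3^7"
  where "act3 a w = (\<chi> k. wext w (shift a (Some k)))"

lemma sum_shift: "(\<Sum>i\<in>UNIV. f (shift a i)) = (\<Sum>i\<in>UNIV. f i)"
  by (rule sum.reindex_bij_betw) (rule bij_shift)

lemma wext_act3 [simp]: "wext (act3 a w) i = wext w (shift a i)"
  using wext_vec[of "\<lambda>i. wext w (shift a i)"] by (simp add: act3_def sum_shift sum_wext)

text \<open>An arbitrary numbering of the eight points, used only to store functions on the
  projective line as vectors of type \<open>7^8\<close>.\<close>

definition index :: "pt \<Rightarrow> 8"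
  where "index = (SOME f. bij f)"

lemma bij_index: "bij index"
proof -
  have "\<exists>f :: pt \<Rightarrow> 8. bij f"
    by (rule finite_same_card_bij) (simp_all add: card_UNIV_option)
  then show ?thesis unfolding index_def by (rule someI_ex)
qed

definition of_vec8 :: "7^8 \<Rightarrow> pt \<Rightarrow> 7"
  where "of_vec8 m i = m $ index i"

definition to_vec8 :: "(pt \<Rightarrow> 7) \<Rightarrow> 7^8"
  where "to_vec8 f = (\<chi> j. f (inv_into UNIV index j))"

lemma of_to_vec8 [simp]: "of_vec8 (to_vec8 f) = f"
  using bij_index by (simp add: of_vec8_def to_vec8_def fun_eq_iff bij_is_inj)

lemma of_vec8_inject: "of_vec8 m = of_vec8 n \<Longrightarrow> m = n"
  using bij_is_surj[OF bij_index] unfolding vec_eq_iff fun_eq_iff of_vec8_def by (metis surjD)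

lemma of_vec8_add [simp]: "of_vec8 (m + n) i = of_vec8 m i + of_vec8 n i"
  by (simp add: of_vec8_def)

lemma of_vec8_0 [simp]: "of_vec8 0 i = 0"
  by (simp add: of_vec8_def)

text \<open>The isomorphism u \<mapsto> 2^u from the integers modulo 3 onto the cube roots of unity
  in F_7, which are also its nonzero squares.\<close>

definition cube_root :: "3 \<Rightarrow> 7"
  where "cube_root u = (if u = 0 then 1 else if u = 1 then 2 else 4)"

lemma cube_root_0 [simp]: "cube_root 0 = 1"
  by (simp add: cube_root_def)

lemma cube_root_add: "cube_root (u + v) = cube_root u * cube_root v"
proof -
  have "\<forall>u v. cube_root (u + v) = cube_root u * cube_root v"
    unfolding all_mod_3 by (simp add: cube_root_def)
  then show ?thesis by blast
qed

lemma cube_root_minus: "cube_root u * cube_root (- u) = 1"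
  by (simp flip: cube_root_add)

lemma cube_root_square: "(cube_root u)^2 = cube_root (- u)"
proof -
  have "\<forall>u. (cube_root u)^2 = cube_root (- u)"
    unfolding all_mod_3 by (simp add: cube_root_def)
  then show ?thesis by blast
qed

lemma cube_root_inject: "cube_root u = cube_root v \<Longrightarrow> u = v"
proof -
  have "\<forall>u v. cube_root u = cube_root v \<longrightarrow> u = v"
    unfolding all_mod_3 by (simp add: cube_root_def)
  then show "cube_root u = cube_root v \<Longrightarrow> u = v" by blast
qed

lemma ex_cube_root: "x \<noteq> 0 \<Longrightarrow> \<exists>u. x^2 = cube_root u"
proof -
  have "\<forall>x::7. x \<noteq> 0 \<longrightarrow> x^2 \<in> {cube_root 0, cube_root 1, cube_root 2}"
    unfolding all_mod_7 by (simp add: cube_root_def)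
  then show "x \<noteq> 0 \<Longrightarrow> \<exists>u. x^2 = cube_root u" by blast
qed

definition act7 :: "(3^7) \<times> (2^3) \<Rightarrow> 7^8 \<Rightarrow> 7^8"
  where "act7 = (\<lambda>(w, a) m. to_vec8 (\<lambda>i. cube_root (wext w i) * of_vec8 m (shift a i)))"

section \<open>The iterated semidirect product and its solvability\<close>

lemma group_additive_group: "group (additive_group :: 'a::ab_group_add monoid)"
proof (rule groupI)
  fix x :: 'a
  show "\<exists>y\<in>carrier additive_group. y \<otimes>\<^bsub>additive_group\<^esub> x = \<one>\<^bsub>additive_group\<^esub>"
    by (auto simp: additive_group_def intro!: exI[of _ "- x"])
qed (auto simp: additive_group_def add.assoc)

lemma solvable_additive_group: "solvable (additive_group :: 'a::ab_group_add monoid)"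
proof -
  interpret A: comm_group "additive_group :: 'a monoid"
    by (intro group.group_comm_groupI group_additive_group) (simp add: additive_group_def add.commute)
  show ?thesis
    unfolding A.solvable_iff_trivial_derived_seq using A.derived_eq_singleton[of "carrier additive_group"]
    by (intro exI[of _ 1]) simp
qed

text \<open>Bijectivity of \<phi> h follows from the action laws, because \<phi> of the inverse of h
  undoes it.\<close>

lemma hom_AutoGroupI:
  fixes \<phi> :: "'h \<Rightarrow> 'a::ab_group_add \<Rightarrow> 'a"
  assumes H: "group H"
    and add: "\<And>h x y. h \<in> carrier H \<Longrightarrow> \<phi> h (x + y) = \<phi> h x + \<phi> h y"
    and one: "\<And>x. \<phi> \<one>\<^bsub>H\<^esub> x = x"
    and mult: "\<And>h k x. \<lbrakk>h \<in> carrier H; k \<in> carrier H\<rbrakk> \<Longrightarrow> \<phi> (h \<otimes>\<^bsub>H\<^esub> k) x = \<phi> h (\<phi> k x)"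
  shows "\<phi> \<in> hom H (AutoGroup additive_group)"
proof -
  interpret H: group H by (fact H)
  have "bij (\<phi> h)" if "h \<in> carrier H" for h
    using that one mult[of h "inv\<^bsub>H\<^esub> h"] mult[of "inv\<^bsub>H\<^esub> h" h]
    by (intro o_bij[of "\<phi> (inv\<^bsub>H\<^esub> h)"]) (auto simp: fun_eq_iff)
  then show ?thesis using add mult
    by (auto simp: hom_def AutoGroup_def auto_def BijGroup_def Bij_def additive_group_def
        compose_def fun_eq_iff)
qed

lemma act3_hom: "act3 \<in> hom additive_group (AutoGroup additive_group)"
proof (rule hom_AutoGroupI[OF group_additive_group])
  show "act3 a (v + w) = act3 a v + act3 a w" for a v w
    by (rule wext_inject) (simp add: fun_eq_iff)
  show "act3 \<one>\<^bsub>additive_group\<^esub> w = w" for w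
    by (rule wext_inject) (simp add: fun_eq_iff additive_group_def)
  show "act3 (a \<otimes>\<^bsub>additive_group\<^esub> b) w = act3 a (act3 b w)" for a b w
    by (rule wext_inject) (simp add: fun_eq_iff additive_group_def shift_add[symmetric] add.commute)
qed

abbreviation group32 :: "((3^7) \<times> (2^3)) monoid"
  where "group32 \<equiv> semidirect additive_group additive_group act3"

lemma group_group32: "group group32"
  by (intro group.semidirect_group group_additive_group act3_hom)

lemma act7_hom: "act7 \<in> hom group32 (AutoGroup additive_group)"
proof (rule hom_AutoGroupI[OF group_group32])
  show "act7 p (m + n) = act7 p m + act7 p n" for p m n
    by (rule of_vec8_inject) (simp add: fun_eq_iff act7_def algebra_simps split: prod.split)
  show "act7 \<one>\<^bsub>group32\<^esub> m = m" for m
    by (rule of_vec8_inject) (simp add: fun_eq_iff act7_def semidirect_def additive_group_def)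
  show "act7 (p \<otimes>\<^bsub>group32\<^esub> q) m = act7 p (act7 q m)" for p q m
    by (rule of_vec8_inject)
      (simp add: fun_eq_iff act7_def semidirect_def additive_group_def cube_root_add mult.assoc
        shift_add[symmetric] add.commute split: prod.split)
qed

abbreviation group732 :: "((7^8) \<times> (3^7) \<times> (2^3)) monoid"
  where "group732 \<equiv> semidirect additive_group group32 act7"

lemma group_group732: "group group732"
  by (intro group.semidirect_group group_additive_group group_group32 act7_hom)

lemma solvable_semidirect:
  assumes N: "group N" and H: "group H" and \<phi>: "\<phi> \<in> hom H (AutoGroup N)"
    and "solvable N" "solvable H"
  shows "solvable (semidirect N H \<phi>)"
proof -
  interpret N: group N by (fact N)
  interpret H: group H by (fact H)
  let ?S = "semidirect N H \<phi>"
  have S: "group ?S" using N.semidirect_group[OF H \<phi>] .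
  have id: "\<phi> \<one>\<^bsub>H\<^esub> x = x" if "x \<in> carrier N" for x
    using hom_one[OF \<phi> H N.AutoGroup] that by (simp add: AutoGroup_def BijGroup_def)
  have 1: "group_hom N ?S (\<lambda>n. (n, \<one>\<^bsub>H\<^esub>))"
    using N S id by (auto simp: group_hom_def group_hom_axioms_def hom_def semidirect_def)
  have 2: "group_hom ?S H snd"
    using H S by (auto simp: group_hom_def group_hom_axioms_def hom_def semidirect_def)
  have 3: "snd ` carrier ?S = carrier H"
    using N.one_closed by (force simp: semidirect_def)
  have 4: "kernel ?S H snd \<subseteq> (\<lambda>n. (n, \<one>\<^bsub>H\<^esub>)) ` carrier N"
    by (auto simp: kernel_def semidirect_def)
  show ?thesis using solvable_condition[OF 1 2 3 4] assms by blast
qed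

lemma solvable_group732: "solvable group732"
  by (intro solvable_semidirect group_additive_group group_group32 act3_hom act7_hom
      solvable_additive_group)

text \<open>Offset and slope are taken at the target fibre, which is what makes composition match
  the product of \<open>group732\<close>.\<close>

definition monomial :: "(7^8) \<times> (3^7) \<times> (2^3) \<Rightarrow> pt \<times> 7 \<Rightarrow> pt \<times> 7"
  where "monomial = (\<lambda>(m, w, a) (i, x).
    (shift a i, of_vec8 m (shift a i) + cube_root (wext w (shift a i)) * x))"

lemma monomial_mult: "monomial (p \<otimes>\<^bsub>group732\<^esub> q) = monomial p \<circ> monomial q"
  by (simp add: fun_eq_iff monomial_def semidirect_def additive_group_def act7_def cube_root_add
      algebra_simps shift_add[symmetric] split: prod.split)

lemma monomial_one: "monomial \<one>\<^bsub>group732\<^esub> = id"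
  by (simp add: fun_eq_iff monomial_def semidirect_def additive_group_def)

lemma monomial_inject:
  assumes "monomial p = monomial q"
  shows "p = q"
proof -
  obtain m w a where p: "p = (m, w, a)" by (cases p)
  obtain n v b where q: "q = (n, v, b)" by (cases q)
  have eq: "monomial (m, w, a) (shift a i, x) = monomial (n, v, b) (shift a i, x)" for i x
    using assms p q by simp
  have ab: "a = b" using assms[THEN fun_cong, of "(None, 0)"] p q
    by (auto simp: monomial_def intro: shift_cancel)
  have mn: "of_vec8 m i = of_vec8 n i" for i using eq[of i 0] ab by (simp add: monomial_def)
  moreover have "wext w i = wext v i" for i
    using eq[of i 1] ab mn[of i] by (intro cube_root_inject) (simp add: monomial_def)
  ultimately show ?thesis using p q ab by (auto intro!: of_vec8_inject wext_inject)
qed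

subsection \<open>\<open>PSL\<^sub>2(7)\<close> and \<open>GL\<^sub>3(2)\<close>\<close>

lemma det_minus_one [simp]: "det (- mat 1 :: 7^2^2) = 1"
  by (simp add: det_2)

lemma center_SL: "group_center (SL :: (7^2^2) monoid) = {mat 1, - mat 1}"
proof
  show "group_center SL \<subseteq> {mat 1, - mat 1 :: 7^2^2}"
  proof
    fix z :: "7^2^2" assume "z \<in> group_center SL"
    then have z: "det z = 1" "\<And>g. det g = 1 \<Longrightarrow> z ** g = g ** z"
      by (auto simp: group_center_def carrier_SL)
    have "z ** trans2 1 = trans2 1 ** z" "z ** weyl2 = weyl2 ** z"
      using z(2) by (simp_all add: det_2)
    then have "z$2$1 = 0" "z$1$1 = z$2$2" "z$1$2 = 0"
      by (auto simp: mat2_eq_iff algebra_simps)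
    then show "z \<in> {mat 1, - mat 1}" using z(1)
      by (auto simp: det_2 mat2_eq_iff square_eq_1_mod_7[unfolded power2_eq_square])
  qed
next
  show "{mat 1, - mat 1 :: 7^2^2} \<subseteq> group_center SL"
    by (auto simp: group_center_def carrier_SL mat2_eq_iff)
qed

lemma group_GL: "group (GL :: ('a::comm_ring_1^'n^'n) monoid)"
proof (rule groupI)
  fix A B :: "'a^'n^'n" assume "A \<in> carrier GL" "B \<in> carrier GL"
  then show "A \<otimes>\<^bsub>GL\<^esub> B \<in> carrier GL" by (simp add: GL_def invertible_mult)
next
  fix A :: "'a^'n^'n" assume "A \<in> carrier GL"
  then show "\<exists>B\<in>carrier GL. B \<otimes>\<^bsub>GL\<^esub> A = \<one>\<^bsub>GL\<^esub>"
    by (auto simp: GL_def invertible_def)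
qed (auto simp: GL_def matrix_mul_assoc invertible_def intro: exI[of _ "mat 1"])

lemma lin_minus_one: "lin (- mat 1) = mat 1"
  using flag_act_minus_one
  by (intro lin_eqI) (auto simp: linear_part_def flag_act_def fun_eq_iff)

lemma invertible_lin:
  assumes "det g = 1"
  shows "invertible (lin g)"
  using assms lin_mult[of g "adj2 g"] lin_mult[of "adj2 g" g]
  by (auto simp: invertible_def adj2 det_adj2 intro!: exI[of _ "lin (adj2 g)"])

lemma lin_hom: "lin \<in> hom SL GL"
  by (auto simp: hom_def carrier_SL GL_def invertible_lin lin_mult)

lemma kernel_lin: "kernel SL GL lin = {mat 1, - mat 1}"
  using moebius_translation by (auto simp: kernel_def carrier_SL GL_def lin_minus_one)

lemma lin_eq_imp_flag_act_eq:
  assumes "det g = 1" "det h = 1" "lin g = lin h"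
  shows "flag_act g = flag_act h"
proof -
  let ?k = "g ** adj2 h"
  have k: "det ?k = 1" using assms by (simp add: det_mul det_adj2)
  have "lin ?k = lin (h ** adj2 h)" using assms by (simp add: lin_mult det_adj2)
  then have "lin ?k = mat 1" using assms by (simp add: adj2)
  from moebius_translation[OF k this] have "flag_act ?k = id"
    using flag_act_one flag_act_minus_one by auto
  moreover have "?k ** h = g" using assms by (simp add: adj2 flip: matrix_mul_assoc)
  ultimately show ?thesis using flag_act_mult[OF assms(2), of ?k] by simp
qed

text \<open>Every unit of F_7 is a cube root of unity up to sign. A point, a cube root of unity and
  an upper right entry therefore give 8 * 3 * 7 = 168 representatives modulo the centre.\<close>

definition flag_rep :: "pt \<times> 3 \<times> 7 \<Rightarrow> 7^2^2"
  where "flag_rep = (\<lambda>(i, u, t). frame i ** mat2 (cube_root u) t 0 (cube_root (- u)))"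

lemma det_flag_rep [simp]: "det (flag_rep p) = 1"
  by (cases p) (simp add: flag_rep_def det_mul, simp add: det_2 cube_root_minus)

lemma flag_act_flag_rep:
  "flag_act (flag_rep (i, u, t)) (None, x) = (i, cube_root u * t + cube_root (- u) * x)"
proof -
  let ?b = "mat2 (cube_root u) t 0 (cube_root (- u))"
  have "det ?b = 1" by (simp add: det_2 cube_root_minus)
  moreover have "moebius ?b None = None"
    by (simp add: moebius_def point_def mult_vec2_nth col_def)
  ultimately show ?thesis
    by (simp add: flag_rep_def flag_act_mult flag_act_None flag_act_frame)
      (simp add: borel_def cube_root_square)
qed

text \<open>The flag action depends only on \<open>lin\<close>, and its values at
  (\<open>None\<close>, 0) and (\<open>None\<close>, 1) recover the three parameters.\<close>

lemma inj_lin_flag_rep: "inj (\<lambda>p. lin (flag_rep p))"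
proof (rule injI)
  fix p q assume "lin (flag_rep p) = lin (flag_rep q)"
  then have eq: "flag_act (flag_rep p) = flag_act (flag_rep q)"
    by (intro lin_eq_imp_flag_act_eq) auto
  obtain i u t where p: "p = (i, u, t)" by (cases p)
  obtain j v s where q: "q = (j, v, s)" by (cases q)
  have "i = j" and 0: "cube_root u * t = cube_root v * s"
    and "cube_root u * t + cube_root (- u) = cube_root v * s + cube_root (- v)"
    using eq[THEN fun_cong, of "(None, 0)"] eq[THEN fun_cong, of "(None, 1)"] p q
    by (auto simp: flag_act_flag_rep)
  then have "u = v" by (auto dest: cube_root_inject)
  have "cube_root (- u) * (cube_root u * t) = cube_root (- u) * (cube_root u * s)"
    using 0 \<open>u = v\<close> by simp
  then have "t = s" by (simp flip: mult.assoc cube_root_add)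
  with \<open>i = j\<close> \<open>u = v\<close> show "p = q" by (simp add: p q)
qed

text \<open>An invertible matrix is determined by its columns, each lying outside the span of the
  previous ones: 7 * 6 * 4 = 168.\<close>

lemma card_GL_3_2: "card {A :: 2^3^3. invertible A} \<le> 168"
proof -
  let ?T = "SIGMA u:- {0 :: 2^3}. SIGMA v:- {0, u}. - {0, u, v, u + v}"
  let ?e = "vector [1, 0, 0] :: 2^3" and ?f = "vector [0, 1, 0] :: 2^3"
    and ?g = "vector [0, 0, 1] :: 2^3"
  let ?c = "\<lambda>A :: 2^3^3. (A *v ?e, A *v ?f, A *v ?g)"
  have add_eq_0: "x + y = 0 \<longleftrightarrow> x = y" for x y :: "2^3"
    by (metis add_left_imp_eq add_self_vec_mod_2)
  have "card (- {0, u, v, u + v}) = 4" if "u \<in> - {0}" "v \<in> - {0, u}" for u v :: "2^3"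
    using that unfolding Compl_eq_Diff_UNIV by (subst card_Diff_subset) (auto simp: add_eq_0 eq_commute[of 0])
  then have "card (SIGMA v:- {0, u}. - {0, u, v, u + v}) = 24" if "u \<in> - {0}" for u :: "2^3"
    using that by (subst card_SigmaI) (auto simp: Compl_eq_Diff_UNIV card_Diff_subset)
  then have card: "card ?T = 168" by (subst card_SigmaI) (auto simp: Compl_eq_Diff_UNIV card_Diff_subset)
  have "?c ` {A. invertible A} \<subseteq> ?T"
  proof
    fix p assume "p \<in> ?c ` {A. invertible A}"
    then obtain A where A: "invertible A" "p = ?c A" by auto
    obtain B where "B ** A = mat 1" using A(1) by (auto simp: invertible_def)
    then have "B *v (A *v x) = x" for x by (simp add: matrix_vector_mul_assoc)
    then have inj: "A *v x = A *v y \<longleftrightarrow> x = y" for x y by metis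
    have [simp]: "A *v x = 0 \<longleftrightarrow> x = 0" for x using inj[of x 0] by simp
    show "p \<in> ?T" unfolding A(2)
      by (simp add: inj flip: matrix_vector_right_distrib) (simp add: vec3_eq_iff)
  qed
  moreover have "inj ?c"
    by (rule injI) (auto simp: vec_eq_iff[where 'b = 3] forall_3 mult_vec3_nth)
  ultimately have "card {A :: 2^3^3. invertible A} \<le> card ?T"
    by (intro card_inj_on_le[of ?c]) (auto intro: inj_on_subset)
  with card show ?thesis by simp
qed

text \<open>The image contains the 168 values on \<open>flag_rep\<close>, and the target has at most
  168 elements.\<close>

lemma lin_onto: "lin ` carrier SL = carrier GL"
proof (rule card_seteq)
  show "lin ` carrier SL \<subseteq> carrier GL" using lin_hom by (auto simp: hom_def)
  have "card (carrier (GL :: (2^3^3) monoid)) \<le> 168" using card_GL_3_2 by (simp add: GL_def)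
  also have "168 = card (range (\<lambda>p. lin (flag_rep p)))"
    by (subst card_image[OF inj_lin_flag_rep]) (simp add: card_UNIV_option)
  also have "\<dots> \<le> card (lin ` carrier SL)"
    by (rule card_mono) (auto simp: carrier_SL)
  finally show "card (carrier (GL :: (2^3^3) monoid)) \<le> card (lin ` carrier SL)" .
qed simp

lemma group_PSL: "group (PSL :: (7^2^2) set monoid)"
proof -
  have "group_hom SL GL lin"
    using group_SL group_GL lin_hom by (simp add: group_hom_def group_hom_axioms_def)
  from normal.factorgroup_is_group[OF group_hom.normal_kernel[OF this]]
  show ?thesis by (simp add: PSL_def center_SL kernel_lin)
qed

lemma PSL_iso_GL: "(PSL :: (7^2^2) set monoid) \<cong> (GL :: (2^3^3) monoid)"
proof -
  have "group_hom SL GL lin"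
    using group_SL group_GL lin_hom by (simp add: group_hom_def group_hom_axioms_def)
  from group_hom.FactGroup_iso[OF this lin_onto] show ?thesis
    by (simp add: PSL_def center_SL kernel_lin)
qed

text \<open>Conjugation by diag(2, 4) multiplies the parameter of an upper transvection by 4 and of
  a lower one by 2. Commutators with it thus give transvections from which both generators of
  \<open>SL2_induct\<close> are built.\<close>

lemma derived_SL: "derived SL (carrier SL) = carrier (SL :: (7^2^2) monoid)"
proof
  interpret SL: group "SL :: (7^2^2) monoid" by (fact group_SL)
  let ?D = "derived SL (carrier SL) :: (7^2^2) set"
  show "?D \<subseteq> carrier SL" by (rule SL.derived_in_carrier) simp
  have D: "subgroup ?D SL" by (rule SL.derived_is_subgroup) simp
  have inv: "inv\<^bsub>SL\<^esub> g = adj2 g" if "det g = 1" for g :: "7^2^2"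
    using that by (intro SL.inv_equality) (auto simp: carrier_SL adj2 det_adj2)
  have comm: "g ** h ** adj2 g ** adj2 h \<in> ?D" if "det g = 1" "det h = 1" for g h
    unfolding derived_def using that
    by (intro generate.incl) (auto simp: carrier_SL inv intro!: bexI[of _ g] bexI[of _ h])
  let ?d = "mat2 2 0 0 4"
  have d: "det ?d = 1" by (simp add: det_2)
  have seven: "(7::7) = 0" by simp
  have T: "trans2 (3 * x) \<in> ?D" for x
  proof -
    have "trans2 (3 * x) = ?d ** trans2 x ** adj2 ?d ** adj2 (trans2 x)"
      by (simp add: mat2_eq_iff adj2_def) (subst seven, simp)
    then show ?thesis using comm[OF d, of "trans2 x"] by (simp add: det_2)
  qed
  have "mat2 1 0 1 1 = ?d ** mat2 1 0 1 1 ** adj2 ?d ** adj2 (mat2 1 0 1 1)"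
    by (simp add: mat2_eq_iff adj2_def)
  then have L: "mat2 1 0 1 1 \<in> ?D" using comm[OF d, of "mat2 1 0 1 1"] by (simp add: det_2)
  have "trans2 (3 * 2) ** mat2 1 0 1 1 ** trans2 (3 * 2) \<in> ?D"
    using T[of 2] L subgroup.m_closed[OF D] by simp
  also have "trans2 (3 * 2) ** mat2 1 0 1 1 ** trans2 (3 * 2) = weyl2"
    by (simp add: mat2_eq_iff)
  finally have S: "weyl2 \<in> ?D" .
  have "trans2 1 = trans2 (3 * 5)" by (simp add: mat2_eq_iff)
  then have T1: "trans2 1 \<in> ?D" using T by metis
  show "carrier SL \<subseteq> ?D"
  proof
    fix g :: "7^2^2" assume "g \<in> carrier SL"
    then have "det g = 1" by (simp add: carrier_SL)
    then show "g \<in> ?D"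
      by (rule SL2_induct) (use S T1 subgroup.m_closed[OF D] in auto)
  qed
qed

lemma (in group) perfect_not_solvable:
  assumes "derived G (carrier G) = carrier G" "carrier G \<noteq> {\<one>}"
  shows "\<not> solvable G"
proof -
  have "(derived G ^^ n) (carrier G) = carrier G" for n
    by (induction n) (simp_all add: assms(1))
  with assms(2) show ?thesis by (simp add: solvable_iff_trivial_derived_seq)
qed

subsection \<open>The factorisation\<close>

definition perm_group :: "('a \<Rightarrow> 'a) monoid"
  where "perm_group = \<lparr>carrier = {f. bij f}, mult = (\<circ>), one = id\<rparr>"

lemma perm_group_simps [simp]: "carrier perm_group = {f. bij f}" "mult perm_group = (\<circ>)"
  "one perm_group = id"
  by (simp_all add: perm_group_def)

lemma group_perm_group: "group perm_group"
proof (rule groupI)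
  fix f :: "'a \<Rightarrow> 'a" assume "f \<in> carrier perm_group"
  then show "\<exists>g\<in>carrier perm_group. g \<otimes>\<^bsub>perm_group\<^esub> f = \<one>\<^bsub>perm_group\<^esub>"
    by (intro bexI[of _ "inv_into UNIV f"]) (auto simp: bij_imp_bij_inv bij_is_inj)
qed (auto simp: bij_comp o_assoc)

lemma bij_flag_act: "det g = 1 \<Longrightarrow> bij (flag_act g)"
  by (rule o_bij[of "flag_act (adj2 g)"])
    (simp_all add: flag_act_one adj2 det_adj2 flip: flag_act_mult)

lemma bij_moebius: "det g = 1 \<Longrightarrow> bij (moebius g)"
  by (rule o_bij[of "moebius (adj2 g)"])
    (simp_all add: fun_eq_iff adj2 det_adj2 flip: moebius_mult)

lemma bij_monomial: "bij (monomial p)"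
proof -
  interpret group group732 by (fact group_group732)
  have p: "p \<in> carrier group732" by (cases p) (simp add: semidirect_def additive_group_def)
  show ?thesis
    by (rule o_bij[of "monomial (inv\<^bsub>group732\<^esub> p)"])
      (use p in \<open>simp_all add: monomial_one flip: monomial_mult\<close>)
qed

text \<open>The slope on each fibre is the square of a unit, hence a cube root of unity.\<close>

lemma flag_act_affine:
  assumes "det g = 1"
  shows "\<exists>t u. \<forall>i x. flag_act g (i, x) = (moebius g i, t i + cube_root (u i) * x)"
proof -
  have "\<exists>u. ((cocycle g i)$1$1)^2 = cube_root u" for i
    using det_cocycle[OF assms, of i] cocycle_triangular[OF assms, of i]
    by (intro ex_cube_root) (auto simp: det_2)
  then obtain u where "\<And>i. ((cocycle g i)$1$1)^2 = cube_root (u i)" by metis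
  then show ?thesis
    by (intro exI[of _ "\<lambda>i. (cocycle g i)$1$1 * (cocycle g i)$1$2"] exI[of _ u])
      (simp add: flag_act_def borel_def)
qed

text \<open>The exponents u of g may have any sum, but conjugation introduces them only as
  differences u(i) - u(\<open>shift a i\<close>), which sum to 0 over the line. So the conjugate
  again has exponents of sum 0.\<close>

lemma flag_act_normalises:
  assumes g: "det g = 1"
  shows "\<exists>q. flag_act g \<circ> monomial p = monomial q \<circ> flag_act g"
proof -
  obtain m w a where p: "p = (m, w, a)" by (cases p)
  obtain t u where tu: "\<And>i x. flag_act g (i, x) = (moebius g i, t i + cube_root (u i) * x)"
    using flag_act_affine[OF g] by metis
  define r where "r = moebius (adj2 g)"
  have r: "r (moebius g i) = i" for i
    using moebius_mult[OF g, of "adj2 g" i] g by (simp add: r_def adj2)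
  \<comment> \<open>The exponents v and offsets n solve the required equation fibre by fibre,
    indexed by the target point.\<close>
  define v where "v j = u (r j) + wext w (r j) - u (shift a (r j))" for j
  define n where "n j = t (r j) + cube_root (u (r j)) * of_vec8 m (r j)
    - cube_root (v j) * t (shift a (r j))" for j
  have "(\<Sum>j\<in>UNIV. v j) = (\<Sum>i\<in>UNIV. v (moebius g i))"
    by (rule sum.reindex_bij_betw[symmetric]) (rule bij_moebius[OF g])
  also have "\<dots> = 0"
    by (simp add: v_def r sum.distrib sum_subtractf sum_wext sum_shift)
  finally have v: "wext (\<chi> k. v (Some k)) = v" by (rule wext_vec)
  let ?q = "(to_vec8 n, \<chi> k. v (Some k), lin g *v a)"
  have "flag_act g (monomial p (i, x)) = monomial ?q (flag_act g (i, x))" for i x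
  proof -
    let ?l = "shift a i" and ?j = "moebius g (shift a i)"
    have "v ?j + u i = u ?l + wext w ?l" by (simp add: v_def r)
    then have "cube_root (v ?j) * cube_root (u i) = cube_root (u ?l) * cube_root (wext w ?l)"
      by (simp flip: cube_root_add)
    then have "n ?j + cube_root (v ?j) * (t i + cube_root (u i) * x)
        = t ?l + cube_root (u ?l) * (of_vec8 m ?l + cube_root (wext w ?l) * x)"
      by (simp add: n_def r distrib_left flip: mult.assoc)
    then show ?thesis by (simp add: p monomial_def tu v flip: moebius_shift[OF g])
  qed
  then show ?thesis by (auto simp: fun_eq_iff)
qed

definition flag_stabiliser :: "(pt \<times> 7 \<Rightarrow> pt \<times> 7) set"
  where "flag_stabiliser = {f. bij f \<and> (\<forall>x. f (None, x) = (None, x))}"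

definition flag_group :: "(pt \<times> 7 \<Rightarrow> pt \<times> 7) set"
  where "flag_group = flag_act ` carrier SL"

lemma inv_perm_group: "bij f \<Longrightarrow> inv\<^bsub>perm_group\<^esub> f = inv_into UNIV f"
  by (rule group.inv_equality[OF group_perm_group]) (auto simp: bij_is_inj bij_imp_bij_inv)

lemma subgroup_flag_stabiliser: "subgroup flag_stabiliser perm_group"
proof -
  interpret group "perm_group :: (pt \<times> 7 \<Rightarrow> pt \<times> 7) monoid" by (fact group_perm_group)
  show ?thesis
  proof (rule subgroupI)
    show "flag_stabiliser \<noteq> {}" by (auto simp: flag_stabiliser_def intro: exI[of _ id])
    show "inv\<^bsub>perm_group\<^esub> f \<in> flag_stabiliser" if "f \<in> flag_stabiliser" for f
      using that by (auto simp: flag_stabiliser_def inv_perm_group bij_imp_bij_inv bij_is_inj inv_f_eq)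
  qed (auto simp: flag_stabiliser_def bij_comp)
qed

lemma flag_act_group_hom: "group_hom SL perm_group flag_act"
  using group_SL group_perm_group
  by (auto simp: group_hom_def group_hom_axioms_def hom_def carrier_SL bij_flag_act flag_act_mult)

lemma subgroup_flag_group: "subgroup flag_group perm_group"
  unfolding flag_group_def by (rule group_hom.img_is_subgroup[OF flag_act_group_hom])

lemma factorisation:
  assumes f: "inj f"
  shows "factorisation (image_group f group732) perm_group (monomial \<circ> inv_into UNIV f)
    flag_stabiliser flag_group"
proof -
  have UNIV: "carrier group732 = UNIV" by (simp add: semidirect_def additive_group_def)
  let ?N = "image_group f group732" and ?\<iota> = "monomial \<circ> inv_into UNIV f"
  have N: "group ?N" using group.inj_imp_image_group_is_group[OF group_group732, of f] f by (simp add: UNIV)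
  have \<iota>: "?\<iota> ` carrier ?N = range monomial"
  proof -
    have "?\<iota> ` carrier ?N = monomial ` ((inv_into UNIV f \<circ> f) ` UNIV)"
      by (simp only: image_group_carrier UNIV image_comp o_assoc)
    also have "inv_into UNIV f \<circ> f = id" using f by (simp add: fun_eq_iff)
    finally show ?thesis by simp
  qed
  have G: "group (perm_group :: (pt \<times> 7 \<Rightarrow> pt \<times> 7) monoid)" by (fact group_perm_group)
  show ?thesis
  proof (intro factorisation.intro N G factorisation_axioms.intro
      subgroup_flag_stabiliser subgroup_flag_group)
    show "?\<iota> \<in> hom ?N perm_group"
      using f by (auto simp: hom_def image_group_def UNIV bij_monomial monomial_mult)
    show "inj_on ?\<iota> (carrier ?N)"
      using f by (auto simp: inj_on_def image_group_carrier dest: monomial_inject)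
  next
    fix y n assume "y \<in> flag_group" "n \<in> carrier ?N"
    then obtain g where g: "det g = 1" "y = flag_act g"
      by (auto simp: flag_group_def carrier_SL)
    obtain p where p: "?\<iota> n = monomial p" by simp
    obtain q where q: "flag_act g \<circ> monomial p = monomial q \<circ> flag_act g"
      using flag_act_normalises[OF g(1)] by blast
    have "y \<otimes>\<^bsub>perm_group\<^esub> ?\<iota> n \<otimes>\<^bsub>perm_group\<^esub> inv\<^bsub>perm_group\<^esub> y
        = monomial q \<circ> (flag_act g \<circ> inv_into UNIV (flag_act g))"
      unfolding p g(2) using bij_flag_act[OF g(1)] by (simp add: q inv_perm_group o_assoc)
    also have "\<dots> = monomial q"
      using bij_is_surj[OF bij_flag_act[OF g(1)]] by (simp add: surj_iff)
    finally show "y \<otimes>\<^bsub>perm_group\<^esub> ?\<iota> n \<otimes>\<^bsub>perm_group\<^esub> inv\<^bsub>perm_group\<^esub> y \<in> ?\<iota> ` carrier ?N"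
      unfolding \<iota> by simp
  next
    show "flag_stabiliser \<inter> flag_group = {\<one>\<^bsub>perm_group\<^esub>}"
    proof
      show "flag_stabiliser \<inter> flag_group \<subseteq> {\<one>\<^bsub>perm_group\<^esub>}"
        using fixes_flags_None flag_act_one flag_act_minus_one
        by (fastforce simp: flag_stabiliser_def flag_group_def carrier_SL)
    qed (use subgroup.one_closed[OF subgroup_flag_stabiliser] subgroup.one_closed[OF subgroup_flag_group]
      in auto)
  next
    fix n assume "n \<in> carrier ?N"
    obtain m w a where p: "?\<iota> n = monomial (m, w, a)" by (cases "inv_into UNIV f n") auto
    let ?u = "wext w None"
    \<comment> \<open>Chosen to invert the given permutation over infinity. With c =
      \<open>cube_root ?u\<close> the offset t must satisfy m + c^2 t = 0, and c^3 = 1 gives t = - c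
      m.\<close>
    let ?g = "flag_rep (shift a None, ?u, - cube_root ?u * of_vec8 m None)"
    have "(?\<iota> n \<circ> flag_act ?g) (None, x) = (None, x)" for x
      unfolding p
      by (simp add: flag_act_flag_rep monomial_def algebra_simps)
        (simp add: power2_eq_square[symmetric] cube_root_square cube_root_minus flip: mult.assoc)
    then have "?\<iota> n \<otimes>\<^bsub>perm_group\<^esub> flag_act ?g \<in> flag_stabiliser"
      by (simp add: flag_stabiliser_def p bij_comp bij_monomial bij_flag_act)
    moreover have "flag_act ?g \<in> flag_group"
      unfolding flag_group_def by (rule imageI) (simp add: carrier_SL)
    ultimately show "\<exists>y\<in>flag_group. ?\<iota> n \<otimes>\<^bsub>perm_group\<^esub> y \<in> flag_stabiliser"
      by blast
  next
    fix y assume "y \<in> flag_group"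
    then obtain g where g: "det g = 1" "y = flag_act g" by (auto simp: flag_group_def carrier_SL)
    obtain t u where tu: "\<And>i x. flag_act g (i, x) = (moebius g i, t i + cube_root (u i) * x)"
      using flag_act_affine[OF g(1)] by metis
    obtain a where a: "shift a (moebius g None) = None" using ex_shift by blast
    \<comment> \<open>Only the exponent at infinity is prescribed; the opposite value at the point 0
      restores the sum 0. Likewise only the offset at infinity matters, so a constant is
      used.\<close>
    let ?v = "\<lambda>i. if i = None then - u None else if i = Some 0 then u None else 0"
    have v: "wext (\<chi> k. ?v (Some k)) = ?v" by (rule wext_vec) (simp add: sum_pt)
    let ?p = "(to_vec8 (\<lambda>i. - cube_root (- u None) * t None), (\<chi> k. ?v (Some k)), a)"
    have "(monomial ?p \<circ> flag_act g) (None, x) = (None, x)" for x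
    proof -
      let ?c = "cube_root (- u None)"
      have "- ?c * t None + ?c * (t None + cube_root (u None) * x)
          = cube_root (u None) * ?c * x"
        by (simp add: algebra_simps)
      also have "\<dots> = x" by (simp only: cube_root_minus mult_1)
      finally show ?thesis
        unfolding monomial_def by (simp only: o_apply tu case_prod_conv a v of_to_vec8 simp_thms if_True)
    qed
    then have stab: "monomial ?p \<otimes>\<^bsub>perm_group\<^esub> y \<in> flag_stabiliser"
      by (simp add: flag_stabiliser_def g bij_comp bij_monomial bij_flag_act)
    have "monomial ?p \<in> ?\<iota> ` carrier ?N" unfolding \<iota> by (rule rangeI)
    then obtain n where n: "monomial ?p = ?\<iota> n" "n \<in> carrier ?N" by (rule imageE)
    show "\<exists>n\<in>carrier ?N. ?\<iota> n \<otimes>\<^bsub>perm_group\<^esub> y \<in> flag_stabiliser"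
      using stab[unfolded n(1)] n(2) by (rule bexI)
  qed
qed

section \<open>The flag group is isomorphic to PSL_2(7) and insoluble\<close>

lemma kernel_flag_act: "kernel SL (perm_group\<lparr>carrier := flag_group\<rparr>) flag_act = {mat 1, - mat 1}"
proof
  show "kernel SL (perm_group\<lparr>carrier := flag_group\<rparr>) flag_act \<subseteq> {mat 1, - mat 1}"
  proof
    fix g assume "g \<in> kernel SL (perm_group\<lparr>carrier := flag_group\<rparr>) flag_act"
    then have "det g = 1" "flag_act g = id" by (simp_all add: kernel_def carrier_SL)
    with fixes_flags_None[of g] show "g \<in> {mat 1, - mat 1}" by simp
  qed
qed (auto simp: kernel_def carrier_SL flag_act_one flag_act_minus_one)

lemma flag_act_hom: "group_hom SL (perm_group\<lparr>carrier := flag_group\<rparr>) flag_act"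
  using flag_act_group_hom group.subgroup_imp_group[OF group_perm_group subgroup_flag_group]
  by (auto simp: group_hom_def group_hom_axioms_def hom_def flag_group_def)

lemma PSL_iso_flag_group: "(PSL :: (7^2^2) set monoid) \<cong> perm_group\<lparr>carrier := flag_group\<rparr>"
proof -
  have "flag_act ` carrier SL = carrier (perm_group\<lparr>carrier := flag_group\<rparr>)"
    by (simp add: flag_group_def)
  from group_hom.FactGroup_iso[OF flag_act_hom this] show ?thesis
    by (simp add: PSL_def center_SL kernel_flag_act)
qed

lemma flag_group_not_solvable: "\<not> solvable (perm_group\<lparr>carrier := flag_group\<rparr>)"
proof -
  interpret group_hom SL "perm_group\<lparr>carrier := flag_group\<rparr>" flag_act by (fact flag_act_hom)
  have "flag_act weyl2 (None, 0) \<noteq> (None, 0)"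
    by (simp add: flag_act_def moebius_def point_def col_def mult_vec2_nth)
  moreover have "flag_act weyl2 \<in> flag_group" by (auto simp: flag_group_def carrier_SL det_2)
  ultimately have "flag_group \<noteq> {id}" by (metis id_apply singletonD)
  moreover have "derived (perm_group\<lparr>carrier := flag_group\<rparr>) flag_group = flag_group"
    using derived_img[of "carrier SL"] by (simp add: derived_SL flag_group_def)
  ultimately show ?thesis by (intro H.perfect_not_solvable) simp_all
qed

text \<open>Inversion reverses products; this accounts for the opposite group in the
  theorem.\<close>

lemma (in group) iso_opposite_group: "G \<cong> opposite_group G"
proof (rule is_isoI)
  show "m_inv G \<in> iso G (opposite_group G)"
    by (auto simp: iso_def hom_def opposite_group_def inv_mult_group intro!: bij_betw_byWitness[where f' = "m_inv G"])
qed

lemma ex_brace: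
  obtains B :: "nat ring" where "skew_brace B" "finite (carrier B)" "solvable (add_monoid B)"
    "\<not> solvable B" "add_monoid B \<cong> opposite_group group732"
    "\<exists>H. H \<lhd> B \<and> solvable (B\<lparr>carrier := H\<rparr>) \<and> B Mod H \<cong> (GL :: (2^3^3) monoid)"
proof -
  \<comment> \<open>The finite group is copied onto natural numbers, the element type in
    \<open>Byott_conjecture\<close>.\<close>
  obtain f :: "(7^8) \<times> (3^7) \<times> (2^3) \<Rightarrow> nat" where f: "inj f"
    using finite_imp_inj_to_nat_seg[OF finite] by blast
  let ?N = "image_group f group732" and ?Q = "perm_group\<lparr>carrier := flag_group\<rparr>"
  interpret factorisation ?N perm_group "monomial \<circ> inv_into UNIV f" flag_stabiliser flag_group
    using f by (rule factorisation)
  have Q: "group ?Q" using G.subgroup_imp_group[OF subgroup_flag_group] .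
  have N_iso: "group732 \<cong> ?N"
    using f by (auto intro!: is_isoI[OF inj_imp_image_group_iso] intro: inj_on_subset)
  interpret B: skew_brace brace by (fact skew_brace)
  interpret h: group_hom brace ?Q cofactor
    using group_brace Q cofactor_hom by (simp add: group_hom_def group_hom_axioms_def)
  have onto: "cofactor ` carrier brace = carrier ?Q" using cofactor_onto by simp
  have sol: "solvable (add_monoid brace)"
    unfolding add_monoid_brace using iso_solvable[OF group_group732 N.is_group N_iso solvable_group732] .
  have not_sol: "\<not> solvable brace"
    using h.surj_hom_imp_solvable[OF onto] flag_group_not_solvable by blast
  have "solvable (brace\<lparr>carrier := kernel brace ?Q cofactor\<rparr>)"
    by (intro B.solvable_kernel Q cofactor_hom sol) (auto simp: circle_trivial)
  \<comment> \<open>The quotient is the image Y of \<open>cofactor\<close>; it is PSL_2(7) through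
    the flag action and then GL_3(2) through \<open>lin\<close>.\<close>
  moreover have "brace Mod kernel brace ?Q cofactor \<cong> (GL :: (2^3^3) monoid)"
    by (rule iso_trans[OF h.FactGroup_iso[OF onto]
          iso_trans[OF group.iso_sym[OF group_PSL PSL_iso_flag_group] PSL_iso_GL]])
  ultimately have "\<exists>H. H \<lhd> brace \<and> solvable (brace\<lparr>carrier := H\<rparr>) \<and> brace Mod H \<cong> (GL :: (2^3^3) monoid)"
    using h.normal_kernel by blast
  moreover have "add_monoid brace \<cong> opposite_group group732"
    unfolding add_monoid_brace
    by (rule iso_trans[OF group.iso_sym[OF group_group732 N_iso]
          group.iso_opposite_group[OF group_group732]])
  moreover have "finite (carrier brace)"
    by (simp add: image_group_carrier)
  ultimately show ?thesis using that[OF skew_brace _ sol not_sol] by blast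
qed

theorem mainTheorem1:
  shows "(\<exists>B :: nat ring.
      skew_brace B \<and> finite (carrier B) \<and>
      solvable (add_monoid B) \<and> \<not> solvable B \<and>
      (\<exists>\<phi> \<in> hom (additive_group :: (2^3) monoid) (AutoGroup (additive_group :: (3^7) monoid)).
       \<exists>\<psi> \<in> hom (semidirect (additive_group :: (3^7) monoid) (additive_group :: (2^3) monoid) \<phi>)
               (AutoGroup (additive_group :: (7^8) monoid)).
         add_monoid B \<cong>
           opposite_group (semidirect (additive_group :: (7^8) monoid)
             (semidirect (additive_group :: (3^7) monoid) (additive_group :: (2^3) monoid) \<phi>) \<psi>)) \<and>
      (\<exists>H. H \<lhd> B \<and> solvable (B\<lparr>carrier := H\<rparr>) \<and>
         B Mod H \<cong> (GL :: (2^3^3) monoid) \<and>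
         (GL :: (2^3^3) monoid) \<cong> (PSL :: (7^2^2) set monoid)))
    \<and> \<not> Byott_conjecture
    \<and> (\<exists>N :: nat monoid. group N \<and> finite (carrier N) \<and> solvable N \<and>
        (\<exists>R. regular_subgroup R N \<and> \<not> solvable ((Hol N)\<lparr>carrier := R\<rparr>)))"
proof -
  obtain B :: "nat ring" where B: "skew_brace B" "finite (carrier B)" "solvable (add_monoid B)"
    "\<not> solvable B" "add_monoid B \<cong> opposite_group group732"
    "\<exists>H. H \<lhd> B \<and> solvable (B\<lparr>carrier := H\<rparr>) \<and> B Mod H \<cong> (GL :: (2^3^3) monoid)"
    by (rule ex_brace)
  interpret B: skew_brace B by (fact B(1))
  have GL: "(GL :: (2^3^3) monoid) \<cong> (PSL :: (7^2^2) set monoid)"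
    using group.iso_sym[OF group_PSL PSL_iso_GL] .
  define R where "R = (\<lambda>a. (a, B.lam a)) ` carrier B"
  have R: "regular_subgroup R (add_monoid B)" "B \<cong> Hol (add_monoid B)\<lparr>carrier := R\<rparr>"
    "group (Hol (add_monoid B)\<lparr>carrier := R\<rparr>)"
    unfolding R_def by (fact B.regular_subgroup_lam)+
  have "\<not> solvable (Hol (add_monoid B)\<lparr>carrier := R\<rparr>)"
    using iso_solvable group.iso_sym[OF B.mult_group R(2)] B(4) B.mult_group R(3) by blast
  then have ex: "\<exists>N :: nat monoid. group N \<and> finite (carrier N) \<and> solvable N \<and>
        (\<exists>R. regular_subgroup R N \<and> \<not> solvable ((Hol N)\<lparr>carrier := R\<rparr>))"
    using B.add_group B(2,3) R(1) by (intro exI[of _ "add_monoid B"]) auto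
  then have "\<not> Byott_conjecture" unfolding Byott_conjecture_def by blast
  with ex show ?thesis using B GL act3_hom act7_hom by blast
qed

end
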